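(* Let $F$ be a cdf on $\mathbb R$ such that its quantile function $Q=F^{-1}$ is integrable on $(0,1)$ and locally absolutely continuous, and let $q$ be a density for $Q$. Then $(h\circ Q)q\in L^1(0,1)$ for each $h\in D^1(\mathbb R)$. Moreover, the map $\phi:\mathbb D_F\subset D^1(\mathbb R)\to L^1(0,1)$ defined by $\phi(\tilde G)=G^{-1}$ is Hadamard differentiable at $\tilde F$ tangentially to $T_F$, with Hadamard derivative $\dot\phi_{\tilde F}:T_F\to L^1(0,1)$ satisfying $$\dot\phi_{\tilde F}(h)=-(h\circ Q)q\quad\text{for each }h\in T_F.$$ The last equality defines a continuous and linear extension of $\dot\phi_{\tilde F}$ to all of $D^1(\mathbb R)$.
   Context: $L^1(0,1)$ is the space of Lebesgue integrable functions $f:(0,1)\to\mathbb R$ (functions equal off a Lebesgue null set are identified) with norm $\lVert f\rVert_1=\int_0^1|f(u)|\,\mathrm{d}u$. $D(\mathbb R)$ is the space of real càdlàg functions on $\mathbb R$, and $D^1(\mathbb R)$ is the subspace of Lebesgue integrable $h\in D(\mathbb R)$ with norm $\lVert h\rVert_1=\int_{-\infty}^\infty|h(x)|\,\mathrm{d}x$. For a cdf $G\in D(\mathbb R)$, the quantile function is $G^{-1}:(0,1)\to\mathbb R$, $G^{-1}(u)=\inf\{x\in\mathbb R:G(x)\ge u\}$. The modified cdf $\tilde G$ is $\tilde G(x)=G(x)-\mathbf 1(x\ge0)$, $x\in\mathbb R$; this is a one-to-one correspondence between cdfs and modified cdfs, and $\tilde G\in D^1(\mathbb R)$ if and only if $G^{-1}\in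 L^1(0,1)$. For a cdf $F$ let $\alpha_F=\inf\{x\in\mathbb R:F(x)>0\}$ and $\beta_F=\sup\{x\in\mathbb R:F(x)<1\}$ (possibly infinite), and $$\mathbb D_F=\{\tilde G\in D^1(\mathbb R): G\text{ is a cdf},\ G(\alpha_F-)=0\text{ and }G(\beta_F+)=1\},$$ where $G(x-)$ and $G(x+)$ are left and right limits, and the condition $G(\alpha_F-)=0$ (respectively $G(\beta_F+)=1$) is regarded as automatically satisfied if $\alpha_F=-\infty$ (respectively $\beta_F=+\infty$). The tangent space is $$T_F=\{h\in D^1(\mathbb R): h=g\circ F\text{ for some }g\in C[0,1]\text{ with }g(0)=g(1)=0\},$$ a subspace of $D^1(\mathbb R)$, where $C[0,1]$ is the space of real continuous functions on $[0,1]$. $Q$ is locally absolutely continuous if its restriction to each compact subinterval of $(0,1)$ is absolutely continuous. A density for such $Q$ is a nonnegative locally integrable $q:(0,1)\to\mathbb R$ with $Q(b)-Q(a)=\int_a^bq(u)\,\mathrm{d}u$ for $0<a<b<1$, unique up to null sets. Hadamard differentiability: a map $\phi:\mathbb D_F\subset D^1(\mathbb R)\to L^1(0,1)$ is Hadamard differentiable at $\theta\in\mathbb D_F$ tangentially to $T_F$, with derivative $\dot\phi_\theta$, if $\dot\phi_\theta:T_F\to L^1(0,1)$ is a continuous linear map such that $$\left\lVert \frac{\phi(\theta+t_nh_n)-\phi(\theta)}{t_n}-\dot\phi_\theta(h)\right\rVert_1\to0$$ for every $h\in T_F$, every sequence of positive reals $t_n\to0$, and every sequence $(h_n)$ in $D^1(\mathbb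 R)$ with $\lVert h_n-h\rVert_1\to0$ and $\theta+t_nh_n\in\mathbb D_F$ for all $n$. *)

theory Defs
  imports "HOL-Probability.Probability"
begin

definition is_cdf :: "(real \<Rightarrow> real) \<Rightarrow> bool" where
  "is_cdf G \<longleftrightarrow> (\<exists>M. real_distribution M \<and> G = cdf M)"

definition cadlag :: "(real \<Rightarrow> real) \<Rightarrow> bool" where
  "cadlag h \<longleftrightarrow> (\<forall>x. (h \<longlongrightarrow> h x) (at_right x) \<and> (\<exists>l. (h \<longlongrightarrow> l) (at_left x)))"

text \<open>
  Elements of \<open>L\<^sup>1(0,1)\<close> are represented by functions \<open>real \<Rightarrow> real\<close> whose values outside
  \<open>(0,1)\<close> are irrelevant; \<open>eq_L1\<close> is the identification of functions equal off a null set.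
  No identification is needed for \<open>D1\<close>: by right-continuity, an element of \<open>D1\<close> that vanishes
  almost everywhere vanishes everywhere.
\<close>

definition L1 :: "(real \<Rightarrow> real) set" where
  "L1 = {f. integrable (lebesgue_on {0<..<1}) f}"

definition norm_L1 :: "(real \<Rightarrow> real) \<Rightarrow> real" where
  "norm_L1 f = (LINT u|lebesgue_on {0<..<1}. \<bar>f u\<bar>)"

definition eq_L1 :: "(real \<Rightarrow> real) \<Rightarrow> (real \<Rightarrow> real) \<Rightarrow> bool" where
  "eq_L1 f g \<longleftrightarrow> (AE u in lebesgue_on {0<..<1}. f u = g u)"

definition D1 :: "(real \<Rightarrow> real) set" where
  "D1 = {h. cadlag h \<and> integrable lebesgue h}"

definition norm_D1 :: "(real \<Rightarrow> real) \<Rightarrow> real" where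
  "norm_D1 h = (LINT x|lebesgue. \<bar>h x\<bar>)"

definition quantile :: "(real \<Rightarrow> real) \<Rightarrow> real \<Rightarrow> real" where
  "quantile G u = Inf {x. G x \<ge> u}"

definition modified_cdf :: "(real \<Rightarrow> real) \<Rightarrow> real \<Rightarrow> real" where
  "modified_cdf G = (\<lambda>x. G x - indicat_real {0..} x)"

text \<open>The map \<open>\<phi>\<close>: it first recovers the cdf from its modified version.\<close>

definition quantile_map :: "(real \<Rightarrow> real) \<Rightarrow> real \<Rightarrow> real" where
  "quantile_map g = quantile (\<lambda>x. g x + indicat_real {0..} x)"

lemma quantile_map_modified_cdf: "quantile_map (modified_cdf G) = quantile G"
  by (simp add: quantile_map_def modified_cdf_def)

definition lower_endpoint :: "(real \<Rightarrow> real) \<Rightarrow> ereal" where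
  "lower_endpoint F = Inf (ereal ` {x. F x > 0})"

definition upper_endpoint :: "(real \<Rightarrow> real) \<Rightarrow> ereal" where
  "upper_endpoint F = Sup (ereal ` {x. F x < 1})"

definition D_dom :: "(real \<Rightarrow> real) \<Rightarrow> (real \<Rightarrow> real) set" where
  "D_dom F = {modified_cdf G | G. is_cdf G \<and> modified_cdf G \<in> D1 \<and>
     (\<forall>a. lower_endpoint F = ereal a \<longrightarrow> (G \<longlongrightarrow> 0) (at_left a)) \<and>
     (\<forall>b. upper_endpoint F = ereal b \<longrightarrow> (G \<longlongrightarrow> 1) (at_right b))}"

definition T_space :: "(real \<Rightarrow> real) \<Rightarrow> (real \<Rightarrow> real) set" where
  "T_space F = {h \<in> D1. \<exists>g. continuous_on {0..1} g \<and> g 0 = 0 \<and> g 1 = 0 \<and> h = g \<circ> F}"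

definition absolutely_continuous_on :: "real \<Rightarrow> real \<Rightarrow> (real \<Rightarrow> real) \<Rightarrow> bool" where
  "absolutely_continuous_on a b f \<longleftrightarrow>
     (\<forall>\<epsilon>>0. \<exists>\<delta>>0. \<forall>(n::nat) l r.
        (\<forall>i<n. a \<le> l i \<and> l i \<le> r i \<and> r i \<le> b) \<and>
        (\<forall>i<n. \<forall>j<n. i \<noteq> j \<longrightarrow> {l i<..<r i} \<inter> {l j<..<r j} = {}) \<and>
        (\<Sum>i<n. r i - l i) < \<delta> \<longrightarrow> (\<Sum>i<n. \<bar>f (r i) - f (l i)\<bar>) < \<epsilon>)"

definition locally_absolutely_continuous :: "(real \<Rightarrow> real) \<Rightarrow> bool" where
  "locally_absolutely_continuous Q \<longleftrightarrow>
     (\<forall>a b. 0 < a \<and> a < b \<and> b < 1 \<longrightarrow> absolutely_continuous_on a b Q)"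

definition is_density_of :: "(real \<Rightarrow> real) \<Rightarrow> (real \<Rightarrow> real) \<Rightarrow> bool" where
  "is_density_of q Q \<longleftrightarrow>
     (\<forall>u\<in>{0<..<1}. q u \<ge> 0) \<and>
     (\<forall>a b. 0 < a \<and> a < b \<and> b < 1 \<longrightarrow>
        integrable (lebesgue_on {a..b}) q \<and> Q b - Q a = (LINT u|lebesgue_on {a..b}. q u))"

text \<open>\<open>A\<close> is a continuous linear map into \<open>L\<^sup>1(0,1)\<close> from the linear subspace \<open>V\<close> of \<open>D1\<close>.\<close>

definition continuous_linear_L1 ::
    "(real \<Rightarrow> real) set \<Rightarrow> ((real \<Rightarrow> real) \<Rightarrow> real \<Rightarrow> real) \<Rightarrow> bool" where
  "continuous_linear_L1 V A \<longleftrightarrow>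
     (\<forall>h\<in>V. A h \<in> L1) \<and>
     (\<forall>h\<in>V. \<forall>k\<in>V. eq_L1 (A (\<lambda>x. h x + k x)) (\<lambda>u. A h u + A k u)) \<and>
     (\<forall>h\<in>V. \<forall>c. eq_L1 (A (\<lambda>x. c * h x)) (\<lambda>u. c * A h u)) \<and>
     (\<forall>h\<in>V. \<forall>\<epsilon>>0. \<exists>\<delta>>0. \<forall>k\<in>V.
        norm_D1 (\<lambda>x. k x - h x) < \<delta> \<longrightarrow> norm_L1 (\<lambda>u. A k u - A h u) < \<epsilon>)"

text \<open>
  Hadamard differentiability of \<open>\<phi> : D \<rightarrow> L\<^sup>1(0,1)\<close> at \<open>\<theta>\<close> tangentially to \<open>T\<close>, where
  \<open>D\<close> and \<open>T\<close> are subsets of \<open>D1\<close>. The first three conjuncts say that \<open>\<phi>\<close> really is such a map.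
\<close>

definition has_hadamard_derivative ::
    "((real \<Rightarrow> real) \<Rightarrow> real \<Rightarrow> real) \<Rightarrow> (real \<Rightarrow> real) set \<Rightarrow> (real \<Rightarrow> real) \<Rightarrow>
     (real \<Rightarrow> real) set \<Rightarrow> ((real \<Rightarrow> real) \<Rightarrow> real \<Rightarrow> real) \<Rightarrow> bool" where
  "has_hadamard_derivative \<phi> D \<theta> T \<phi>' \<longleftrightarrow>
     D \<subseteq> D1 \<and> \<theta> \<in> D \<and> (\<forall>g\<in>D. \<phi> g \<in> L1) \<and>
     T \<subseteq> D1 \<and> continuous_linear_L1 T \<phi>' \<and>
     (\<forall>h\<in>T. \<forall>(t :: nat \<Rightarrow> real) (H :: nat \<Rightarrow> real \<Rightarrow> real).
        (\<forall>n. t n > 0) \<and> t \<longlonglongrightarrow> 0 \<and>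
        (\<forall>n. H n \<in> D1) \<and> (\<lambda>n. norm_D1 (\<lambda>x. H n x - h x)) \<longlonglongrightarrow> 0 \<and>
        (\<forall>n. (\<lambda>x. \<theta> x + t n * H n x) \<in> D) \<longrightarrow>
        (\<lambda>n. norm_L1 (\<lambda>u. (\<phi> (\<lambda>x. \<theta> x + t n * H n x) u - \<phi> \<theta> u) / t n - \<phi>' h u)) \<longlonglongrightarrow> 0)"

end

theory Submission
  imports Defs
begin

text \<open>
  Since \<open>u \<le> G z\<close> iff \<open>G\<^sup>-\<^sup>1 u \<le> z\<close>, the difference \<open>G\<^sup>-\<^sup>1 u - F\<^sup>-\<^sup>1 u\<close> is the integral over \<open>z\<close> of
  \<open>1(G z < u) - 1(F z < u)\<close>. By Tonelli this integral, extended to arbitrary \<open>G\<close>, is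
  nonexpansive in \<open>G\<close> for the \<open>L\<^sup>1\<close> norms, so \<open>F + t\<^sub>n h\<^sub>n\<close> may be replaced by
  \<open>F + t\<^sub>n h\<close> with \<open>h = g \<circ> F\<close>, at cost \<open>t\<^sub>n \<parallel>h\<^sub>n - h\<parallel>\<close>.
  The map \<open>F\<close> pushes Lebesgue measure on \<open>{0 < F < 1}\<close> forward to \<open>q(v) dv\<close>; this turns the
  difference quotient into the integral over \<open>v\<close> of
  \<open>(1(v + t g v < u) - 1(v < u)) q(v) / t\<close>, which is bounded in \<open>L\<^sup>1\<close> by \<open>\<integral> \<bar>g\<bar> q\<close> uniformly in \<open>t\<close>.
  Approximating \<open>q\<close> in \<open>L\<^sup>1(\<bar>g\<bar> dv)\<close> by a bounded continuous function, one obtains the limit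
  \<open>- g q\<close> by substituting \<open>v = u - t s\<close> and dominated convergence. The same push-forward
  identity shows that \<open>Q(F z) = z\<close> where \<open>0 < F z < 1\<close>, hence \<open>F(Q u) = u\<close> for
  \<open>q(u) du\<close>-almost every \<open>u\<close> and \<open>g q = (h \<circ> Q) q\<close>.
\<close>

section \<open>Integrals over level sets\<close>

text \<open>As a function of \<open>u\<close> this is the signed indicator of the half-open interval
  between \<open>a\<close> and \<open>b\<close>, positive when \<open>a < b\<close>. The strict
  comparison matches \<open>z < Q u\<close> iff \<open>F z < u\<close>, so a gap of two cdf values
  is also a gap of two quantiles.\<close>

definition gap :: "real \<Rightarrow> real \<Rightarrow> real \<Rightarrow> real" where
  "gap a b u = (if a < u then 1 else 0) - (if b < u then 1 else 0)"

text \<open>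
  For cdfs \<open>A\<close> and \<open>B\<close>, \<open>level_diff A B (\<lambda>_. 1)\<close> is the difference of the quantile functions on
  \<open>(0,1)\<close>. Unlike that difference it makes sense for nonmonotone \<open>A\<close>, such as \<open>F + t h\<close> with
  \<open>h\<close> a tangent direction.
\<close>

definition level_diff :: "(real \<Rightarrow> real) \<Rightarrow> (real \<Rightarrow> real) \<Rightarrow> (real \<Rightarrow> real) \<Rightarrow> real \<Rightarrow> real" where
  "level_diff A B k u = (LINT z|lborel. gap (A z) (B z) u * k z)"

lemma gap_same [simp]: "gap a a u = 0"
  by (simp add: gap_def)

lemma gap_add: "gap a b u + gap b c u = gap a c u"
  by (simp add: gap_def)

lemma borel_measurable_gap [measurable (raw)]:
  assumes [measurable]: "f \<in> borel_measurable M" "g \<in> borel_measurable M" "h \<in> borel_measurable M"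
  shows "(\<lambda>x. gap (f x) (g x) (h x)) \<in> borel_measurable M"
  unfolding gap_def by measurable

text \<open>The order \<open>b - a\<close> matters: raising the first level lowers the integral.
  This is the source of the minus sign in the derivative.\<close>

lemma has_bochner_integral_gap:
  "has_bochner_integral lborel (\<lambda>u. gap a b u) (b - a)"
proof -
  have "has_bochner_integral lborel (\<lambda>u. indicat_real {a<..b} u - indicat_real {b<..a} u)
      (measure lborel {a<..b} - measure lborel {b<..a})"
    by (intro has_bochner_integral_diff has_bochner_integral_real_indicator)
       (cases "a \<le> b"; cases "b \<le> a"; simp)+
  also have "measure lborel {a<..b} - measure lborel {b<..a} = b - a"
    by (cases "a \<le> b") (auto simp: measure_lborel_Ioc)
  also have "(\<lambda>u. indicat_real {a<..b} u - indicat_real {b<..a} u) = (\<lambda>u. gap a b u)"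
    by (auto simp: gap_def indicator_def)
  finally show ?thesis .
qed

lemma nn_integral_gap:
  "(\<integral>\<^sup>+u. ennreal \<bar>gap a b u\<bar> \<partial>lborel) = ennreal \<bar>a - b\<bar>"
proof -
  have "(\<integral>\<^sup>+u. ennreal \<bar>gap a b u\<bar> \<partial>lborel) = (\<integral>\<^sup>+u. indicator {min a b<..max a b} u \<partial>lborel)"
    by (intro nn_integral_cong) (auto simp: gap_def indicator_def)
  also have "\<dots> = ennreal \<bar>a - b\<bar>"
    by (simp add: abs_real_def min_def max_def)
  finally show ?thesis .
qed

text \<open>The counterpart for integration over the position \<open>z\<close> at a fixed level;
  \<open>x\<close> and \<open>y\<close> will be two quantiles.\<close>

lemma integral_gap_shift:
  "(LINT z|lborel. (if z < y then 1 else 0) - (if z < x then 1 else 0)) = (y - x :: real)"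
proof -
  have "has_bochner_integral lborel (\<lambda>u. indicat_real {x..<y} u - indicat_real {y..<x} u)
      (measure lborel {x..<y} - measure lborel {y..<x})"
    by (intro has_bochner_integral_diff has_bochner_integral_real_indicator)
       (cases "x \<le> y"; cases "y \<le> x"; simp)+
  also have "measure lborel {x..<y} - measure lborel {y..<x} = y - x"
    by (cases "x \<le> y") (auto simp: measure_lborel_Ico)
  also have "(\<lambda>u. indicat_real {x..<y} u - indicat_real {y..<x} u)
      = (\<lambda>z. (if z < y then 1 else 0) - (if z < x then 1 else 0))"
    by (auto simp: indicator_def)
  finally show ?thesis by (rule has_bochner_integral_integral_eq)
qed

text \<open>Tonelli, with the level as first and the position as second coordinate: at position
  \<open>z\<close> the set of levels where the gap is nonzero has length
  \<open>\<bar>A z - B z\<bar>\<close>.\<close>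

lemma nn_integral_gap_pair:
  assumes [measurable]: "A \<in> borel_measurable borel" "B \<in> borel_measurable borel" "k \<in> borel_measurable borel"
  shows "(\<integral>\<^sup>+p. ennreal \<bar>gap (A (snd p)) (B (snd p)) (fst p) * k (snd p)\<bar> \<partial>(lborel \<Otimes>\<^sub>M lborel))
     = (\<integral>\<^sup>+z. ennreal \<bar>(A z - B z) * k z\<bar> \<partial>lborel)"
proof -
  have "(\<integral>\<^sup>+p. ennreal \<bar>gap (A (snd p)) (B (snd p)) (fst p) * k (snd p)\<bar> \<partial>(lborel \<Otimes>\<^sub>M lborel))
     = (\<integral>\<^sup>+z. \<integral>\<^sup>+u. ennreal \<bar>gap (A z) (B z) u * k z\<bar> \<partial>lborel \<partial>lborel)"
    by (subst lborel_pair.nn_integral_snd[symmetric]) simp_all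
  also have "\<dots> = (\<integral>\<^sup>+z. ennreal \<bar>(A z - B z) * k z\<bar> \<partial>lborel)"
    by (intro nn_integral_cong)
       (simp add: abs_mult ennreal_mult nn_integral_multc nn_integral_gap)
  finally show ?thesis .
qed

lemma integrable_gap_pair:
  assumes [measurable]: "A \<in> borel_measurable borel" "B \<in> borel_measurable borel" "k \<in> borel_measurable borel"
    and "integrable lborel (\<lambda>z. (A z - B z) * k z)"
  shows "integrable (lborel \<Otimes>\<^sub>M lborel) (\<lambda>p. gap (A (snd p)) (B (snd p)) (fst p) * k (snd p))"
  using assms(4) nn_integral_gap_pair[OF assms(1-3)] by (simp add: integrable_iff_bounded)

lemma AE_integrable_gap:
  assumes "A \<in> borel_measurable borel" "B \<in> borel_measurable borel" "k \<in> borel_measurable borel"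
    and "integrable lborel (\<lambda>z. (A z - B z) * k z)"
  shows "AE u in lborel. integrable lborel (\<lambda>z. gap (A z) (B z) u * k z)"
  using lborel_pair.AE_integrable_fst'[OF integrable_gap_pair[OF assms]] by simp

lemma integrable_level_diff:
  assumes "A \<in> borel_measurable borel" "B \<in> borel_measurable borel" "k \<in> borel_measurable borel"
    and "integrable lborel (\<lambda>z. (A z - B z) * k z)"
  shows "integrable lborel (level_diff A B k)"
  using lborel_pair.integrable_fst'[OF integrable_gap_pair[OF assms]]
  by (simp add: level_diff_def[abs_def])

lemma borel_measurable_level_diff [measurable]:
  assumes [measurable]: "A \<in> borel_measurable borel" "B \<in> borel_measurable borel" "k \<in> borel_measurable borel"
  shows "level_diff A B k \<in> borel_measurable borel"
  unfolding level_diff_def[abs_def] by measurable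

text \<open>Move the absolute value inside the inner integral and evaluate the double integral by
  \<open>nn_integral_gap_pair\<close>. The case \<open>k = 1\<close> measures a change of the
  perturbed function, general \<open>k\<close> a change of the density.\<close>

lemma level_diff_norm_le:
  assumes meas: "A \<in> borel_measurable borel" "B \<in> borel_measurable borel" "k \<in> borel_measurable borel"
    and int: "integrable lborel (\<lambda>z. (A z - B z) * k z)"
  shows "(LINT u|lborel. \<bar>level_diff A B k u\<bar>) \<le> (LINT z|lborel. \<bar>(A z - B z) * k z\<bar>)"
proof -
  let ?f = "\<lambda>p. gap (A (snd p)) (B (snd p)) (fst p) * k (snd p)"
  have i: "integrable (lborel \<Otimes>\<^sub>M lborel) (\<lambda>p. \<bar>?f p\<bar>)"
    using integrable_gap_pair[OF assms] by (rule integrable_abs)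
  have "(LINT u|lborel. \<bar>level_diff A B k u\<bar>) \<le> (LINT u|lborel. LINT z|lborel. \<bar>?f (u, z)\<bar>)"
    using integrable_level_diff[OF assms] lborel_pair.integrable_fst'[OF i]
    by (intro integral_mono integrable_abs) (auto simp: level_diff_def[abs_def] intro!: integral_abs_bound)
  also have "\<dots> = (LINT p|(lborel \<Otimes>\<^sub>M lborel). \<bar>?f p\<bar>)"
    by (rule lborel_pair.integral_fst'[OF i])
  also have "\<dots> = (LINT z|lborel. \<bar>(A z - B z) * k z\<bar>)"
    using nn_integral_gap_pair[OF meas] i int
    by (intro integral_eq_nn_integral[THEN trans])
       (auto simp: integral_eq_nn_integral borel_measurable_integrable)
  finally show ?thesis .
qed

text \<open>Only almost everywhere: at exceptional levels an inner integral may fail to exist and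
  take the default value 0, and additivity can break.\<close>

lemma level_diff_add:
  assumes "A \<in> borel_measurable borel" "B \<in> borel_measurable borel" "C \<in> borel_measurable borel"
    and "k \<in> borel_measurable borel"
    and "integrable lborel (\<lambda>z. (A z - B z) * k z)" "integrable lborel (\<lambda>z. (B z - C z) * k z)"
  shows "AE u in lborel. level_diff A C k u = level_diff A B k u + level_diff B C k u"
  using AE_integrable_gap[OF assms(1,2,4,5)] AE_integrable_gap[OF assms(2,3,4,6)]
proof eventually_elim
  case (elim u)
  have "level_diff A C k u = (LINT z|lborel. gap (A z) (B z) u * k z + gap (B z) (C z) u * k z)"
    by (simp add: level_diff_def gap_add flip: distrib_right)
  then show ?case
    using elim by (simp add: level_diff_def)
qed

lemma level_diff_weight_diff:
  assumes "A \<in> borel_measurable borel" "B \<in> borel_measurable borel"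
    and "k \<in> borel_measurable borel" "l \<in> borel_measurable borel"
    and "integrable lborel (\<lambda>z. (A z - B z) * k z)" "integrable lborel (\<lambda>z. (A z - B z) * l z)"
  shows "AE u in lborel. level_diff A B (\<lambda>z. k z - l z) u = level_diff A B k u - level_diff A B l u"
  using AE_integrable_gap[OF assms(1,2,3,5)] AE_integrable_gap[OF assms(1,2,4,6)]
proof eventually_elim
  case (elim u)
  then show ?case
    by (simp add: level_diff_def right_diff_distrib)
qed

section \<open>Distribution functions and quantiles\<close>

lemma is_cdf_mono: "is_cdf G \<Longrightarrow> mono G"
  by (auto simp: is_cdf_def mono_def real_distribution_def
      intro!: finite_borel_measure.cdf_nondecreasing real_distribution.finite_borel_measure_M)

lemma is_cdf_borel_measurable: "is_cdf G \<Longrightarrow> G \<in> borel_measurable borel"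
  by (rule borel_measurable_mono[OF is_cdf_mono])

lemma is_cdf_bounds:
  assumes "is_cdf G" shows "0 \<le> G x" "G x \<le> 1"
proof -
  obtain M where M: "real_distribution M" "G = cdf M"
    using assms by (auto simp: is_cdf_def)
  then show "0 \<le> G x" "G x \<le> 1"
    using real_distribution.cdf_bounded_prob[OF M(1), of x] by (simp_all add: cdf_def)
qed

text \<open>The Galois connection between a cdf and its generalized inverse. For \<open>u\<close> in
  (0,1) the set under \<open>Inf\<close> is nonempty and bounded below, and right-continuity makes
  the infimum attained.\<close>

lemma quantile_le_iff:
  assumes "is_cdf G" "0 < u" "u < 1"
  shows "quantile G u \<le> x \<longleftrightarrow> u \<le> G x"
proof -
  obtain M where M: "real_distribution M" "G = cdf M"
    using assms by (auto simp: is_cdf_def)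
  interpret cdf_distribution M
    using M by (simp add: cdf_distribution_def)
  show ?thesis
    using pseudoinverse[OF assms(2,3), of x] by (simp add: M quantile_def)
qed

lemma quantile_mono:
  assumes "is_cdf G" "u \<in> {0<..<1}" "v \<in> {0<..<1}" "u \<le> v"
  shows "quantile G u \<le> quantile G v"
  using assms quantile_le_iff[of G v "quantile G v"] quantile_le_iff[of G u "quantile G v"] by simp

lemma quantile_measurable:
  assumes "is_cdf G"
  shows "(\<lambda>u. indicat_real {0<..<1} u * quantile G u) \<in> borel_measurable borel"
proof -
  have "quantile G \<in> borel_measurable (restrict_space borel {0<..<1})"
    using assms by (intro borel_measurable_mono_on_fnc) (auto simp: mono_on_def intro: quantile_mono)
  then show ?thesis
    by (simp add: borel_measurable_restrict_space_iff)
qed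

section \<open>Right-continuous functions with left limits\<close>

lemma is_cdf_cadlag: 
  assumes "is_cdf G" shows "cadlag G"
proof -
  obtain M where M: "real_distribution M" "G = cdf M"
    using assms by (auto simp: is_cdf_def)
  interpret cdf_distribution M
    using M by (simp add: cdf_distribution_def)
  show ?thesis
    unfolding cadlag_def
  proof (intro allI conjI)
    fix x
    show "(G \<longlongrightarrow> G x) (at_right x)"
      using cdf_is_right_cont[of x] by (simp add: M continuous_within)
    show "\<exists>l. (G \<longlongrightarrow> l) (at_left x)"
      using cdf_at_left[of x] by (auto simp: M)
  qed
qed

lemma cadlag_diff:
  assumes "cadlag f" "cadlag g" shows "cadlag (\<lambda>x. f x - g x)"
  unfolding cadlag_def
proof (intro allI conjI)
  fix x
  obtain l m where lm: "(f \<longlongrightarrow> l) (at_left x)" "(g \<longlongrightarrow> m) (at_left x)"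
    using assms unfolding cadlag_def by blast
  show "((\<lambda>x. f x - g x) \<longlongrightarrow> f x - g x) (at_right x)"
    using assms by (intro tendsto_diff) (auto simp: cadlag_def)
  show "\<exists>l. ((\<lambda>x. f x - g x) \<longlongrightarrow> l) (at_left x)"
    using tendsto_diff[OF lm] by blast
qed

lemma cadlag_indicator_atLeast: "cadlag (indicat_real {a..})"
  unfolding cadlag_def
proof (intro allI conjI)
  fix x
  have "eventually (\<lambda>y. indicat_real {a..} y = indicat_real {a..} x) (at_right x)"
  proof (cases "a \<le> x")
    case True then show ?thesis
      by (auto simp: eventually_at_filter indicator_def)
  next
    case False
    then have "eventually (\<lambda>y. y \<in> {x<..<a}) (at_right x)"
      by (intro eventually_at_right_real) simp
    then show ?thesis by eventually_elim (use False in auto)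
  qed
  then show "(indicat_real {a..} \<longlongrightarrow> indicat_real {a..} x) (at_right x)"
    by (rule tendsto_eventually)
  have "\<exists>l. eventually (\<lambda>y. indicat_real {a..} y = l) (at_left x)"
  proof (cases "x \<le> a")
    case True then show ?thesis
      by (intro exI[of _ 0]) (auto simp: eventually_at_filter indicator_def)
  next
    case False
    then have "eventually (\<lambda>y. y \<in> {a<..<x}) (at_left x)"
      by (intro eventually_at_left_real) simp
    then have "eventually (\<lambda>y. indicat_real {a..} y = 1) (at_left x)"
      by eventually_elim auto
    then show ?thesis by blast
  qed
  then show "\<exists>l. (indicat_real {a..} \<longlongrightarrow> l) (at_left x)"
    using tendsto_eventually by blast
qed

text \<open>\<open>s n x\<close> is the first point strictly to the right of \<open>x\<close> on the
  grid of mesh \<open>1 / Suc n\<close>. Composing \<open>h\<close> with \<open>s n\<close> gives a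
  function of an integer floor, hence a Borel one, and right-continuity of \<open>h\<close> gives
  pointwise convergence to \<open>h\<close>.\<close>

lemma cadlag_borel_measurable:
  assumes "cadlag h" shows "h \<in> borel_measurable borel"
proof -
  define s where "s = (\<lambda>n x. (of_int \<lfloor>real (Suc n) * x\<rfloor> + 1) / real (Suc n))"
  have s_gt: "s n x > x" and s_le: "s n x \<le> x + 1 / real (Suc n)" for n x
  proof -
    have "real (Suc n) * x < of_int \<lfloor>real (Suc n) * x\<rfloor> + 1" by linarith
    then show "s n x > x" by (simp add: s_def field_simps)
    have "of_int \<lfloor>real (Suc n) * x\<rfloor> / real (Suc n) \<le> x"
      by (subst pos_divide_le_eq) (simp_all add: mult.commute)
    then show "s n x \<le> x + 1 / real (Suc n)" by (simp add: s_def add_divide_distrib)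
  qed
  have lim: "(\<lambda>n. s n x) \<longlonglongrightarrow> x" for x
  proof (rule tendsto_sandwich)
    show "eventually (\<lambda>n. x \<le> s n x) sequentially"
      using s_gt by (simp add: less_imp_le)
    show "eventually (\<lambda>n. s n x \<le> x + 1 / real (Suc n)) sequentially"
      using s_le by simp
    show "(\<lambda>n. x + 1 / real (Suc n)) \<longlonglongrightarrow> x"
      using tendsto_add[OF tendsto_const LIMSEQ_Suc[OF lim_1_over_n], of x] by simp
  qed simp
  have "(\<lambda>n. h (s n x)) \<longlonglongrightarrow> h x" for x
  proof -
    have "(h \<longlongrightarrow> h x) (at_right x)" using assms by (auto simp: cadlag_def)
    moreover have "filterlim (\<lambda>n. s n x) (at_right x) sequentially"
      using lim s_gt by (auto simp: filterlim_at intro!: always_eventually less_imp_neq[symmetric])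
    ultimately show ?thesis by (rule filterlim_compose)
  qed
  moreover have "(\<lambda>x. h (s n x)) \<in> borel_measurable borel" for n
  proof -
    have "(\<lambda>x. (\<lambda>i::int. h ((of_int i + 1) / real (Suc n))) \<lfloor>real (Suc n) * x\<rfloor>) \<in> borel_measurable borel"
      by measurable
    then show ?thesis by (simp add: s_def)
  qed
  ultimately show ?thesis
    by (rule borel_measurable_LIMSEQ_real)
qed

section \<open>The push-forward of Lebesgue measure under a cdf\<close>

text \<open>Here \<open>q\<close> is a Borel version of the density, nonnegative everywhere and zero
  off (0,1), so that all integrals can run over the whole line.
  \<open>quantile_density_of_density\<close> supplies such a version.\<close>

locale quantile_density =
  fixes F q :: "real \<Rightarrow> real"
  assumes cdf: "is_cdf F"
    and q_measurable [measurable]: "q \<in> borel_measurable borel"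
    and q_nonneg: "\<And>u. 0 \<le> q u"
    and q_outside: "\<And>u. u \<notin> {0<..<1} \<Longrightarrow> q u = 0"
    and q_integrable: "\<And>a b. 0 < a \<Longrightarrow> a < b \<Longrightarrow> b < 1 \<Longrightarrow> integrable lborel (\<lambda>u. indicat_real {a..b} u * q u)"
    and quantile_eq: "\<And>a b. 0 < a \<Longrightarrow> a < b \<Longrightarrow> b < 1 \<Longrightarrow>
      quantile F b - quantile F a = (LINT u|lborel. indicat_real {a..b} u * q u)"
begin

definition S :: "real set" where "S = {z. 0 < F z \<and> F z < 1}"

text \<open>Outside \<open>(0,1)\<close> the quantile function takes junk values, hence the truncation.\<close>

definition Q :: "real \<Rightarrow> real" where
  "Q u = (if u \<in> {0<..<1} then quantile F u else 0)"

lemma F_measurable [measurable]: "F \<in> borel_measurable borel"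
  by (rule is_cdf_borel_measurable[OF cdf])

lemma S_sets [measurable]: "S \<in> sets borel"
  unfolding S_def by measurable

lemma Q_le_iff: "u \<in> {0<..<1} \<Longrightarrow> Q u \<le> x \<longleftrightarrow> u \<le> F x"
  using quantile_le_iff[OF cdf, of u x] by (simp add: Q_def)

lemma less_Q_iff: "u \<in> {0<..<1} \<Longrightarrow> x < Q u \<longleftrightarrow> F x < u"
  using Q_le_iff[of u x] by linarith

lemma Q_measurable [measurable]: "Q \<in> borel_measurable borel"
proof -
  have "Q = (\<lambda>u. indicat_real {0<..<1} u * quantile F u)"
    by (auto simp: Q_def indicator_def)
  then show ?thesis using quantile_measurable[OF cdf] by simp
qed

text \<open>The half-open form is the one needed, since \<open>a \<le> F z \<and> F z < b\<close>
  describes \<open>{Q a..<Q b}\<close>; passing from the closed interval costs only the null set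
  \<open>{b}\<close>.\<close>

lemma nn_integral_q_Ico:
  assumes "0 < a" "a < b" "b < 1"
  shows "(\<integral>\<^sup>+u. indicator {a..<b} u * ennreal (q u) \<partial>lborel) = ennreal (Q b - Q a)"
proof -
  have "(\<integral>\<^sup>+u. indicator {a..<b} u * ennreal (q u) \<partial>lborel)
      = (\<integral>\<^sup>+u. ennreal (indicat_real {a..b} u * q u) \<partial>lborel)"
    by (intro nn_integral_cong_AE eventually_mono[OF AE_lborel_singleton[of b]])
       (auto simp: indicator_def)
  also have "\<dots> = ennreal (LINT u|lborel. indicat_real {a..b} u * q u)"
    by (intro nn_integral_eq_integral q_integrable assms) (simp add: q_nonneg)
  finally show ?thesis
    using quantile_eq[OF assms] assms by (simp add: Q_def)
qed

text \<open>Both measures are compared on the intersection-stable rays \<open>{x..}\<close>. With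
  \<open>c = max a x < b\<close>, the preimage of \<open>{c..<b}\<close> under \<open>F\<close> is
  \<open>{Q c..<Q b}\<close> by the Galois connection, and its length is the integral of
  \<open>q\<close> over \<open>{c..<b}\<close>. The cutoffs \<open>a\<close> and \<open>b\<close>
  keep the measures finite, as the uniqueness theorem requires.\<close>

lemma distr_F_Ico:
  assumes a: "0 < a" and b: "b < 1"
  shows "distr (density lborel (indicator {z. a \<le> F z \<and> F z < b})) borel F
    = density lborel (\<lambda>u. indicator {a..<b} u * ennreal (q u))" (is "?M = ?N")
proof (rule measure_eqI_generator_eq[where E = "range atLeast" and A = "\<lambda>i. {- real i..}"])
  show "Int_stable (range (atLeast :: real \<Rightarrow> real set))"
  proof -
    have "{a..} \<inter> {b..} = {max a b..}" for a b :: real by auto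
    then show ?thesis by (auto simp: Int_stable_def)
  qed
  show "sets ?M = sigma_sets UNIV (range atLeast)" "sets ?N = sigma_sets UNIV (range atLeast)"
    by (simp_all add: borel_Ici)
  have eq: "emeasure ?M {x..} = emeasure ?N {x..}" and fin: "emeasure ?M {x..} \<noteq> \<infinity>" for x
  proof -
    let ?c = "max a x"
    have [measurable]: "F -` {x..} \<in> sets borel"
      by (rule measurable_sets_borel[OF F_measurable]) measurable
    have "emeasure ?M {x..}
        = (\<integral>\<^sup>+z. indicator {z. a \<le> F z \<and> F z < b} z * indicator (F -` {x..}) z \<partial>lborel)"
      by (subst emeasure_distr) (auto simp: emeasure_density)
    also have "\<dots> = (\<integral>\<^sup>+z. indicator {z. ?c \<le> F z \<and> F z < b} z \<partial>lborel)"
      by (intro nn_integral_cong) (auto simp: indicator_def)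
    also have "\<dots> = emeasure lborel {z. ?c \<le> F z \<and> F z < b}"
      by (rule nn_integral_indicator) measurable
    finally have M: "emeasure ?M {x..} = emeasure lborel {z. ?c \<le> F z \<and> F z < b}" .
    have N: "emeasure ?N {x..} = (\<integral>\<^sup>+u. indicator {?c..<b} u * ennreal (q u) \<partial>lborel)"
      by (subst emeasure_density) (auto intro!: nn_integral_cong simp: indicator_def)
    have "emeasure ?M {x..} = emeasure ?N {x..} \<and> emeasure ?M {x..} \<noteq> \<infinity>"
    proof (cases "?c < b")
      case True
      then have "{z. ?c \<le> F z \<and> F z < b} = {Q ?c..<Q b}"
        using a b Q_le_iff[of ?c] less_Q_iff[of b] by auto
      moreover have "Q ?c \<le> Q b" using True a b quantile_mono[OF cdf, of ?c b] by (simp add: Q_def)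
      ultimately show ?thesis
        using M N nn_integral_q_Ico[of ?c b] True a b by simp
    next
      case False
      then have e: "{z. ?c \<le> F z \<and> F z < b} = {}" "{?c..<b} = {}" by auto
      then show ?thesis
        unfolding M N e by simp
    qed
    then show "emeasure ?M {x..} = emeasure ?N {x..}" "emeasure ?M {x..} \<noteq> \<infinity>" by auto
  qed
  show "emeasure ?M X = emeasure ?N X" if "X \<in> range atLeast" for X
    using that eq by auto
  show "emeasure ?M {- real i..} \<noteq> \<infinity>" for i by (rule fin)
  show "(\<Union>i. {- real i..}) = UNIV"
    by (auto simp: minus_le_iff) (meson real_arch_simple)
qed auto

text \<open>Monotone convergence removes the cutoffs of \<open>distr_F_Ico\<close>; both sides may
  be infinite.\<close>

lemma nn_integral_F:
  assumes [measurable]: "f \<in> borel_measurable borel"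
  shows "(\<integral>\<^sup>+z. indicator S z * f (F z) \<partial>lborel) = (\<integral>\<^sup>+u. f u * ennreal (q u) \<partial>lborel)"
proof -
  \<comment> \<open>An increasing exhaustion of (0,1) by half-open intervals with endpoints inside
    (0,1); the shift by 2 makes both endpoints 1/2 at \<open>n = 0\<close>.\<close>
  define J where "J = (\<lambda>n::nat. {1 / real (n + 2)..<1 - 1 / real (n + 2)})"
  have [measurable]: "J n \<in> sets borel" for n
    by (simp add: J_def)
  have J_mono: "J m \<subseteq> J n" if "m \<le> n" for m n
  proof -
    have "1 / real (n + 2) \<le> 1 / real (m + 2)"
      using that by (intro divide_left_mono) auto
    then show ?thesis unfolding J_def by (intro ivl_subset[THEN iffD2] disjI2) auto
  qed
  have J_lim: "(\<lambda>n. indicator (J n) u * c :: ennreal) \<longlonglongrightarrow> indicator {0<..<1} u * c" for u c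
  proof (rule tendsto_eventually)
    show "eventually (\<lambda>n. indicator (J n) u * c = indicator {0<..<1} u * c) sequentially"
    proof (cases "u \<in> {0<..<1}")
      case True
      have "(\<lambda>n. 1 / real (n + 2)) \<longlonglongrightarrow> 0"
        using LIMSEQ_ignore_initial_segment[OF lim_1_over_n, of 2] by simp
      then have "eventually (\<lambda>n. 1 / real (n + 2) < min u (1 - u)) sequentially"
        using True by (intro order_tendstoD) auto
      then show ?thesis
        by eventually_elim (use True in \<open>auto simp: J_def indicator_def\<close>)
    next
      case False
      have "0 < 1 / real (n + 2)" for n by simp
      then have "u \<notin> J n" for n
        using False unfolding J_def by (smt (verit) atLeastLessThan_iff greaterThanLessThan_iff)
      with False show ?thesis by simp
    qed
  qed
  have step: "(\<integral>\<^sup>+z. indicator (J n) (F z) * f (F z) \<partial>lborel)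
      = (\<integral>\<^sup>+u. indicator (J n) u * (f u * ennreal (q u)) \<partial>lborel)" for n
  proof -
    let ?a = "1 / real (n + 2)" and ?b = "1 - 1 / real (n + 2)"
    have "(\<integral>\<^sup>+u. f u \<partial>distr (density lborel (indicator {z. ?a \<le> F z \<and> F z < ?b})) borel F)
        = (\<integral>\<^sup>+u. f u \<partial>density lborel (\<lambda>u. indicator {?a..<?b} u * ennreal (q u)))"
      by (subst distr_F_Ico) simp_all
    then show ?thesis
      by (simp add: nn_integral_distr nn_integral_density J_def indicator_def mult_ac cong: if_cong)
  qed
  have "(\<lambda>n. \<integral>\<^sup>+z. indicator (J n) (F z) * f (F z) \<partial>lborel)
      \<longlonglongrightarrow> (\<integral>\<^sup>+z. indicator {0<..<1} (F z) * f (F z) \<partial>lborel)"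
    using J_mono by (intro nn_integral_LIMSEQ J_lim)
      (auto simp: incseq_def le_fun_def intro!: mult_right_mono indicator_leI)
  moreover have "(\<lambda>n. \<integral>\<^sup>+u. indicator (J n) u * (f u * ennreal (q u)) \<partial>lborel)
      \<longlonglongrightarrow> (\<integral>\<^sup>+u. indicator {0<..<1} u * (f u * ennreal (q u)) \<partial>lborel)"
    using J_mono by (intro nn_integral_LIMSEQ J_lim)
      (auto simp: incseq_def le_fun_def intro!: mult_right_mono indicator_leI)
  ultimately have "(\<integral>\<^sup>+z. indicator {0<..<1} (F z) * f (F z) \<partial>lborel)
      = (\<integral>\<^sup>+u. indicator {0<..<1} u * (f u * ennreal (q u)) \<partial>lborel)"
    unfolding step by (rule LIMSEQ_unique)
  moreover have "(\<integral>\<^sup>+u. indicator {0<..<1} u * (f u * ennreal (q u)) \<partial>lborel)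
      = (\<integral>\<^sup>+u. f u * ennreal (q u) \<partial>lborel)"
    using q_outside by (intro nn_integral_cong) (auto simp: indicator_def)
  moreover have "(\<integral>\<^sup>+z. indicator {0<..<1} (F z) * f (F z) \<partial>lborel)
      = (\<integral>\<^sup>+z. indicator S z * f (F z) \<partial>lborel)"
    by (intro nn_integral_cong) (auto simp: indicator_def S_def)
  ultimately show ?thesis by simp
qed

text \<open>The measure form of \<open>nn_integral_F\<close>, which lets signed Bochner integrals be
  transported as well.\<close>

lemma distr_F: "distr (density lborel (indicator S)) borel F = density lborel (\<lambda>u. ennreal (q u))"
proof (rule measure_eqI)
  fix A assume "A \<in> sets (distr (density lborel (indicator S)) borel F)"
  then have [measurable]: "A \<in> sets borel" by simp
  have [measurable]: "F -` A \<in> sets borel"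
    by (rule measurable_sets_borel[OF F_measurable]) measurable
  have "emeasure (distr (density lborel (indicator S)) borel F) A
      = (\<integral>\<^sup>+z. indicator S z * indicator A (F z) \<partial>lborel)"
    by (subst emeasure_distr) (auto simp: emeasure_density intro!: nn_integral_cong simp: indicator_def)
  also have "\<dots> = emeasure (density lborel (\<lambda>u. ennreal (q u))) A"
    by (subst nn_integral_F) (auto simp: emeasure_density mult.commute)
  finally show "emeasure (distr (density lborel (indicator S)) borel F) A
      = emeasure (density lborel (\<lambda>u. ennreal (q u))) A" .
qed simp

text \<open>Off \<open>S\<close> the function \<open>F\<close> is 0 or 1, possibly on half-lines of
  infinite length; the boundary values of \<open>f\<close> make \<open>f (F z)\<close> vanish there.
  \<open>integral_F\<close> assumes no integrability: when one integral does not exist, neither does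
  the other, and both are 0.\<close>

lemma
  assumes [measurable]: "f \<in> borel_measurable borel" and "f 0 = 0" "f 1 = (0::real)"
  shows integrable_F_iff: "integrable lborel (\<lambda>z. f (F z)) \<longleftrightarrow> integrable lborel (\<lambda>u. f u * q u)"
    and integral_F: "(LINT z|lborel. f (F z)) = (LINT u|lborel. f u * q u)"
proof -
  have f: "f (F z) = indicat_real S z * f (F z)" for z
    using is_cdf_bounds[OF cdf, of z] assms(2,3)
    by (cases "F z = 0 \<or> F z = 1") (auto simp: S_def indicator_def)
  have d: "density lborel (indicator S) = density lborel (\<lambda>z. ennreal (indicat_real S z))"
    by (simp add: ennreal_indicator)
  have "integrable lborel (\<lambda>z. f (F z)) \<longleftrightarrow> integrable (density lborel (indicator S)) (\<lambda>z. f (F z))"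
    unfolding d by (subst integrable_density) (auto simp flip: f)
  also have "\<dots> \<longleftrightarrow> integrable (density lborel (\<lambda>u. ennreal (q u))) f"
    unfolding distr_F[symmetric] by (subst integrable_distr_eq) auto
  also have "\<dots> \<longleftrightarrow> integrable lborel (\<lambda>u. f u * q u)"
    by (subst integrable_density) (auto simp: q_nonneg mult.commute)
  finally show "integrable lborel (\<lambda>z. f (F z)) \<longleftrightarrow> integrable lborel (\<lambda>u. f u * q u)" .
  have "(LINT z|lborel. f (F z)) = (LINT z|density lborel (indicator S). f (F z))"
    unfolding d by (subst integral_density) (auto simp flip: f)
  also have "\<dots> = (LINT u|density lborel (\<lambda>u. ennreal (q u)). f u)"
    unfolding distr_F[symmetric] by (subst integral_distr) auto
  also have "\<dots> = (LINT u|lborel. f u * q u)"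
    by (subst integral_density) (auto simp: q_nonneg mult.commute)
  finally show "(LINT z|lborel. f (F z)) = (LINT u|lborel. f u * q u)" .
qed

text \<open>If \<open>Q (F z) < z\<close>, then \<open>F\<close> is constant between these points,
  so the push-forward of Lebesgue measure on \<open>S\<close> has an atom at \<open>F z\<close>. A
  measure with a density has none.\<close>

lemma Q_F:
  assumes "z \<in> S" shows "Q (F z) = z"
proof (rule ccontr)
  assume "Q (F z) \<noteq> z"
  have Fz: "F z \<in> {0<..<1}" using assms by (simp add: S_def)
  with \<open>Q (F z) \<noteq> z\<close> have less: "Q (F z) < z"
    using Q_le_iff[of "F z" z] by auto
  have const: "F x = F z" if "x \<in> {Q (F z)..z}" for x
    using that Q_le_iff[OF Fz, of x] monoD[OF is_cdf_mono[OF cdf], of x z] by auto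
  have "ennreal (z - Q (F z)) = (\<integral>\<^sup>+x. indicator {Q (F z)..z} x \<partial>lborel)"
    using less by simp
  also have "\<dots> \<le> (\<integral>\<^sup>+x. indicator S x * indicator {F z} (F x) \<partial>lborel)"
  proof (intro nn_integral_mono)
    fix x
    have "x \<in> S \<and> F x = F z" if "x \<in> {Q (F z)..z}"
      using const[OF that] assms by (simp add: S_def)
    then show "indicator {Q (F z)..z} x \<le> (indicator S x * indicator {F z} (F x) :: ennreal)"
      by (auto simp: indicator_def)
  qed
  also have "\<dots> = (\<integral>\<^sup>+u. indicator {F z} u * ennreal (q u) \<partial>lborel)"
    by (rule nn_integral_F) simp
  also have "\<dots> = 0"
  proof -
    have "AE u in lborel. indicator {F z} u * ennreal (q u) = 0"
      using AE_lborel_singleton[of "F z"] by eventually_elim simp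
    then show ?thesis by (simp add: nn_integral_0_iff_AE)
  qed
  finally show False using less by simp
qed

lemma nn_integral_Q:
  assumes [measurable]: "f \<in> borel_measurable borel"
  shows "(\<integral>\<^sup>+u. f (Q u) * ennreal (q u) \<partial>lborel) = (\<integral>\<^sup>+z. indicator S z * f z \<partial>lborel)"
proof -
  have "(\<integral>\<^sup>+z. indicator S z * f z \<partial>lborel) = (\<integral>\<^sup>+z. indicator S z * f (Q (F z)) \<partial>lborel)"
    by (intro nn_integral_cong) (auto simp: indicator_def Q_F)
  then show ?thesis
    by (simp add: nn_integral_F[of "\<lambda>u. f (Q u)"])
qed

text \<open>By \<open>Q_F\<close>, every \<open>u = F z\<close> with \<open>z\<close> in
  \<open>S\<close> satisfies \<open>F (Q u) = u\<close>. So the preimage in \<open>S\<close> of the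
  exceptional levels, those skipped by jumps of \<open>F\<close>, is empty, and the push-forward
  identity shows that \<open>q\<close> vanishes almost everywhere on them.\<close>

lemma AE_F_Q: "AE u in lborel. q u \<noteq> 0 \<longrightarrow> F (Q u) = u"
proof -
  have "(\<integral>\<^sup>+u. indicator {u. F (Q u) \<noteq> u} u * ennreal (q u) \<partial>lborel)
      = (\<integral>\<^sup>+z. indicator S z * indicator {u. F (Q u) \<noteq> u} (F z) \<partial>lborel)"
    by (rule nn_integral_F[symmetric]) measurable
  also have "\<dots> = (\<integral>\<^sup>+(z::real). 0 \<partial>lborel)"
    by (intro nn_integral_cong) (auto simp: indicator_def Q_F)
  finally have "(\<integral>\<^sup>+u. indicator {u. F (Q u) \<noteq> u} u * ennreal (q u) \<partial>lborel) = 0"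
    by simp
  then have "AE u in lborel. indicator {u. F (Q u) \<noteq> u} u * ennreal (q u) = 0"
    by (subst (asm) nn_integral_0_iff_AE) auto
  then show ?thesis
    by eventually_elim (auto simp: indicator_def split: if_splits, metis q_nonneg ennreal_eq_0_iff order_antisym)
qed

text \<open>Composition with \<open>Q\<close> followed by multiplication by \<open>q\<close> is a
  contraction of integrable functions: by \<open>nn_integral_Q\<close> the only mass lost is that of
  \<open>h\<close> outside \<open>S\<close>.\<close>

lemma integrable_Q:
  assumes [measurable]: "h \<in> borel_measurable borel" and "integrable lborel h"
  shows "integrable lborel (\<lambda>u. h (Q u) * q u)"
    and "(LINT u|lborel. \<bar>h (Q u) * q u\<bar>) \<le> (LINT z|lborel. \<bar>h z\<bar>)"
proof -
  have "(\<integral>\<^sup>+u. ennreal \<bar>h (Q u) * q u\<bar> \<partial>lborel) = (\<integral>\<^sup>+u. ennreal \<bar>h (Q u)\<bar> * ennreal (q u) \<partial>lborel)"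
    by (simp add: abs_mult ennreal_mult q_nonneg)
  also have "\<dots> = (\<integral>\<^sup>+z. indicator S z * ennreal \<bar>h z\<bar> \<partial>lborel)"
    by (rule nn_integral_Q[of "\<lambda>z. ennreal \<bar>h z\<bar>"]) simp
  also have "\<dots> \<le> (\<integral>\<^sup>+z. ennreal \<bar>h z\<bar> \<partial>lborel)"
    by (intro nn_integral_mono) (auto simp: indicator_def)
  also have "\<dots> = ennreal (LINT z|lborel. \<bar>h z\<bar>)"
    using assms by (intro nn_integral_eq_integral) auto
  finally have *: "(\<integral>\<^sup>+u. ennreal \<bar>h (Q u) * q u\<bar> \<partial>lborel) \<le> ennreal (LINT z|lborel. \<bar>h z\<bar>)" .
  show **: "integrable lborel (\<lambda>u. h (Q u) * q u)"
    using * by (intro integrableI_bounded) (auto intro: order.strict_trans1)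
  have "ennreal (LINT u|lborel. \<bar>h (Q u) * q u\<bar>) \<le> ennreal (LINT z|lborel. \<bar>h z\<bar>)"
    using * ** by (subst nn_integral_eq_integral[symmetric]) auto
  then show "(LINT u|lborel. \<bar>h (Q u) * q u\<bar>) \<le> (LINT z|lborel. \<bar>h z\<bar>)"
    by (simp add: ennreal_le_iff)
qed

end

section \<open>Infinitesimal perturbations of the identity\<close>

text \<open>The case of a bounded continuous density, by dominated convergence twice: in the
  rescaled variable \<open>s\<close> for each fixed \<open>u\<close>, then in \<open>u\<close> over
  (0,1).\<close>

lemma level_diff_shift_tendsto:
  fixes g k :: "real \<Rightarrow> real" and t :: "nat \<Rightarrow> real"
  assumes g: "continuous_on UNIV g" "\<And>x. \<bar>g x\<bar> \<le> M"
    and k: "continuous_on UNIV k" "\<And>x. \<bar>k x\<bar> \<le> C"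
    and t: "\<And>n. t n > 0" "t \<longlonglongrightarrow> 0"
  shows "(\<lambda>n. LINT u|lborel. indicat_real {0<..<1} u *
      \<bar>level_diff (\<lambda>v. v + t n * g v) (\<lambda>v. v) k u / t n + g u * k u\<bar>) \<longlonglongrightarrow> 0"
proof -
  have [measurable]: "g \<in> borel_measurable borel" "k \<in> borel_measurable borel"
    using g k by (auto intro: borel_measurable_continuous_onI)
  have M: "0 \<le> M" and C: "0 \<le> C"
    using g(2)[of 0] k(2)[of 0] by linarith+
  have scaled: "level_diff (\<lambda>v. v + t n * g v) (\<lambda>v. v) k u / t n
      = (LINT s|lborel. gap (g (u - t n * s)) 0 s * k (u - t n * s))" for n u
  proof -
    \<comment> \<open>With \<open>v = u - t s\<close>, the condition \<open>v + t g v < u\<close>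
      becomes \<open>g v < s\<close> and \<open>v < u\<close> becomes \<open>0 < s\<close>. The
      Jacobian \<open>t\<close> cancels the division by \<open>t\<close>.\<close>
    have "gap (u - t n * s + t n * g (u - t n * s)) (u - t n * s) u = gap (g (u - t n * s)) 0 s" for s
      using t(1)[of n] by (auto simp: gap_def zero_less_mult_iff)
    then show ?thesis
      using t(1)[of n] unfolding level_diff_def
      by (subst lborel_integral_real_affine[of "- t n" _ u]) simp_all
  qed
  \<comment> \<open>The gap is zero unless \<open>s\<close> lies between 0 and \<open>g x\<close>,
    hence in \<open>{-M..M}\<close>; the majorant serves all \<open>n\<close> and
    \<open>u\<close>.\<close>
  let ?b = "\<lambda>s. C * indicat_real {-M..M} s"
  have bound: "\<bar>gap (g x) 0 s * k x\<bar> \<le> ?b s" for x s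
    using g(2)[of x] k(2)[of x] by (auto simp: gap_def indicator_def)
  have b_int: "integrable lborel ?b" and b_val: "(LINT s|lborel. ?b s) = 2 * M * C"
    using M by simp_all
  have lim: "(\<lambda>n. level_diff (\<lambda>v. v + t n * g v) (\<lambda>v. v) k u / t n) \<longlonglongrightarrow> - g u * k u" for u
  proof -
    have shift: "(\<lambda>n. u - t n * s) \<longlonglongrightarrow> u" for s
      using tendsto_diff[OF tendsto_const[of u] tendsto_mult_left_zero[OF t(2), of s]] by simp
    have gl: "(\<lambda>n. g (u - t n * s)) \<longlonglongrightarrow> g u" and kl: "(\<lambda>n. k (u - t n * s)) \<longlonglongrightarrow> k u" for s
      using continuous_on_tendsto_compose[OF g(1) shift] continuous_on_tendsto_compose[OF k(1) shift]
      by auto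
    have "(\<lambda>n. LINT s|lborel. gap (g (u - t n * s)) 0 s * k (u - t n * s))
        \<longlonglongrightarrow> (LINT s|lborel. gap (g u) 0 s * k u)"
    proof (rule integral_dominated_convergence[where w = ?b])
      \<comment> \<open>The level \<open>s = g u\<close>, where the limiting gap jumps, must be left
        out; at every other \<open>s\<close> the gaps are eventually equal to their limit.\<close>
      show "AE s in lborel. (\<lambda>n. gap (g (u - t n * s)) 0 s * k (u - t n * s)) \<longlonglongrightarrow> gap (g u) 0 s * k u"
        using AE_lborel_singleton[of "g u"]
      proof eventually_elim
        case (elim s)
        have "eventually (\<lambda>n. gap (g (u - t n * s)) 0 s = gap (g u) 0 s) sequentially"
        proof (cases "g u < s")
          case True
          then show ?thesis
            using order_tendstoD(2)[OF gl True] by (auto simp: gap_def elim!: eventually_mono)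
        next
          case False
          with elim have "s < g u" by simp
          then show ?thesis
            using order_tendstoD(1)[OF gl, of s s] by (auto simp: gap_def elim!: eventually_mono)
        qed
        then show ?case
          by (intro tendsto_mult kl tendsto_eventually)
      qed
    qed (use bound b_int in auto)
    also have "(LINT s|lborel. gap (g u) 0 s * k u) = - g u * k u"
      using has_bochner_integral_integral_eq[OF has_bochner_integral_gap[of "g u" 0]] by simp
    finally show ?thesis by (simp add: scaled)
  qed
  \<comment> \<open>\<open>2 * M * C\<close> bounds the rescaled integral through \<open>?b\<close>,
    and \<open>M * C\<close> bounds \<open>g u * k u\<close>.\<close>
  have le: "\<bar>level_diff (\<lambda>v. v + t n * g v) (\<lambda>v. v) k u / t n + g u * k u\<bar> \<le> 3 * M * C" for n u
  proof -
    have "\<bar>LINT s|lborel. gap (g (u - t n * s)) 0 s * k (u - t n * s)\<bar> \<le> (LINT s|lborel. ?b s)"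
      using bound by (intro integral_abs_bound_integral b_int) 
        (auto intro!: Bochner_Integration.integrable_bound[OF b_int] AE_I2 order_trans[OF bound abs_ge_self])
    moreover have "\<bar>g u * k u\<bar> \<le> M * C"
      using g(2)[of u] k(2)[of u] M by (auto simp: abs_mult intro: mult_mono)
    ultimately show ?thesis
      unfolding scaled b_val by (simp add: abs_le_iff)
  qed
  have "(\<lambda>n. LINT u|lborel. indicat_real {0<..<1} u *
      \<bar>level_diff (\<lambda>v. v + t n * g v) (\<lambda>v. v) k u / t n + g u * k u\<bar>) \<longlonglongrightarrow> (LINT u|(lborel::real measure). 0)"
  proof (rule integral_dominated_convergence[where w = "\<lambda>u. 3 * M * C * indicat_real {0<..<1} u"])
    show "AE u in lborel. (\<lambda>n. indicat_real {0<..<1} u *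
      \<bar>level_diff (\<lambda>v. v + t n * g v) (\<lambda>v. v) k u / t n + g u * k u\<bar>) \<longlonglongrightarrow> 0"
    proof (intro AE_I2)
      fix u
      have "(\<lambda>n. level_diff (\<lambda>v. v + t n * g v) (\<lambda>v. v) k u / t n + g u * k u) \<longlonglongrightarrow> 0"
        using tendsto_add[OF lim[of u] tendsto_const[of "g u * k u"]] by simp
      then show "(\<lambda>n. indicat_real {0<..<1} u *
          \<bar>level_diff (\<lambda>v. v + t n * g v) (\<lambda>v. v) k u / t n + g u * k u\<bar>) \<longlonglongrightarrow> 0"
        by (intro tendsto_mult_right_zero tendsto_rabs_zero)
    qed
    show "integrable lborel (\<lambda>u::real. 3 * M * C * indicat_real {0<..<1} u)"
      by (intro integrable_mult_right integrable_real_indicator) simp_all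
  qed (use le in \<open>auto simp: indicator_def\<close>)
  then show ?thesis by simp
qed

text \<open>Only the product \<open>g q\<close> is integrable, not necessarily \<open>q\<close>.
  First \<open>q\<close> is truncated at height \<open>m\<close>, with majorant
  \<open>\<bar>g q\<bar>\<close>; then the bounded truncation \<open>p\<close> is approximated
  almost everywhere by continuous functions, with a majorant supported on \<open>{0..1}\<close>
  because \<open>g\<close> is bounded and vanishes elsewhere.\<close>

lemma weighted_approx_continuous:
  fixes g q :: "real \<Rightarrow> real"
  assumes [measurable]: "g \<in> borel_measurable borel" "q \<in> borel_measurable borel"
    and g: "\<And>x. \<bar>g x\<bar> \<le> M" "\<And>x. x \<notin> {0..1} \<Longrightarrow> g x = 0"
    and q: "\<And>x. 0 \<le> q x"
    and gq: "integrable lborel (\<lambda>x. g x * q x)" and "\<epsilon> > 0"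
  obtains k C where "continuous_on UNIV k" "\<And>x. \<bar>k x\<bar> \<le> C"
    "integrable lborel (\<lambda>x. g x * k x)" "(LINT x|lborel. \<bar>g x * (q x - k x)\<bar>) < \<epsilon>"
proof -
  have M: "0 \<le> M" using g(1)[of 0] by linarith
  have g_bdd: "\<bar>g x * c\<bar> \<le> M * B * indicat_real {0..1} x" if "\<bar>c\<bar> \<le> B" for x c B
    using g(1)[of x] g(2)[of x] that M by (auto simp: abs_mult indicator_def intro: mult_mono)
  have bdd_int: "integrable lborel (\<lambda>x. g x * f x)"
    if [measurable]: "f \<in> borel_measurable borel" and "\<And>x. \<bar>f x\<bar> \<le> B" for f B
    by (rule Bochner_Integration.integrable_bound[where f = "\<lambda>x. M * B * indicat_real {0..1} x"])
       (use g_bdd[OF that(2)] in \<open>auto intro: order_trans[OF _ abs_ge_self]\<close>)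
  have "(\<lambda>m. LINT x|lborel. \<bar>g x * (q x - min (q x) (real m))\<bar>) \<longlonglongrightarrow> (LINT x|(lborel::real measure). 0)"
  proof (rule integral_dominated_convergence[where w = "\<lambda>x. \<bar>g x * q x\<bar>"])
    show "AE x in lborel. (\<lambda>m. \<bar>g x * (q x - min (q x) (real m))\<bar>) \<longlonglongrightarrow> 0"
    proof (intro AE_I2 tendsto_eventually)
      fix x
      show "eventually (\<lambda>m. \<bar>g x * (q x - min (q x) (real m))\<bar> = 0) sequentially"
        using eventually_ge_at_top[of "nat \<lceil>q x\<rceil>"]
      proof eventually_elim
        case (elim m)
        then have "q x \<le> real m" by linarith
        then show ?case by simp
      qed
    qed
    show "AE x in lborel. norm \<bar>g x * (q x - min (q x) (real m))\<bar> \<le> \<bar>g x * q x\<bar>" for m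
      using q by (auto simp: abs_mult intro!: mult_left_mono)
  qed (use gq in auto)
  then have "eventually (\<lambda>m. (LINT x|lborel. \<bar>g x * (q x - min (q x) (real m))\<bar>) < \<epsilon> / 2) sequentially"
    using \<open>\<epsilon> > 0\<close> by (intro order_tendstoD) auto
  then obtain m where m: "(LINT x|lborel. \<bar>g x * (q x - min (q x) (real m))\<bar>) < \<epsilon> / 2"
    by (auto simp: eventually_sequentially)
  define p where "p = (\<lambda>x. min (q x) (real m))"
  have [measurable]: "p \<in> borel_measurable borel" unfolding p_def by measurable
  have p_bdd: "\<bar>p x\<bar> \<le> real m" for x using q[of x] by (auto simp: p_def)
  have "p \<in> borel_measurable lebesgue"
    by (simp add: measurable_completion)
  then have "p measurable_on UNIV"
    by (simp add: lebesgue_measurable_imp_measurable_on)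
  then obtain N \<kappa> where N: "negligible N" and \<kappa>: "\<And>n. continuous_on UNIV (\<kappa> n)"
    and \<kappa>_lim: "\<And>x. x \<notin> N \<Longrightarrow> (\<lambda>n. \<kappa> n x) \<longlonglongrightarrow> p x"
    unfolding measurable_on_def by auto
  \<comment> \<open>Since \<open>\<bar>p\<bar> \<le> m\<close>, clamping the approximants to the
    same range keeps their limit and provides the uniform bound for domination.\<close>
  define k where "k = (\<lambda>n x. max (- real m) (min (\<kappa> n x) (real m)))"
  have k_cont: "continuous_on UNIV (k n)" for n
    unfolding k_def by (intro continuous_intros \<kappa>)
  then have [measurable]: "k n \<in> borel_measurable borel" for n
    by (rule borel_measurable_continuous_onI)
  have k_bdd: "\<bar>k n x\<bar> \<le> real m" for n x by (auto simp: k_def)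
  have "N \<in> null_sets lebesgue" using N by (simp add: negligible_iff_null_sets)
  then have AE_N: "AE x in lborel. x \<notin> N"
    using AE_not_in AE_completion_iff by blast
  have "(\<lambda>n. LINT x|lborel. \<bar>g x * (p x - k n x)\<bar>) \<longlonglongrightarrow> (LINT x|(lborel::real measure). 0)"
  proof (rule integral_dominated_convergence[where w = "\<lambda>x. M * (2 * real m) * indicat_real {0..1} x"])
    show "AE x in lborel. (\<lambda>n. \<bar>g x * (p x - k n x)\<bar>) \<longlonglongrightarrow> 0"
      using AE_N
    proof eventually_elim
      case (elim x)
      have "(\<lambda>n. k n x) \<longlonglongrightarrow> max (- real m) (min (p x) (real m))"
        unfolding k_def by (intro tendsto_max tendsto_min tendsto_const \<kappa>_lim elim)
      also have "max (- real m) (min (p x) (real m)) = p x"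
        using p_bdd[of x] by (auto simp: min_def max_def)
      finally have "(\<lambda>n. p x - k n x) \<longlonglongrightarrow> 0"
        using tendsto_diff[OF tendsto_const[of "p x"]] by fastforce
      then show ?case
        by (intro tendsto_rabs_zero tendsto_mult_right_zero)
    qed
    show "AE x in lborel. norm \<bar>g x * (p x - k n x)\<bar> \<le> M * (2 * real m) * indicat_real {0..1} x" for n
    proof (intro AE_I2)
      fix x show "norm \<bar>g x * (p x - k n x)\<bar> \<le> M * (2 * real m) * indicat_real {0..1} x"
        using g_bdd[of "p x - k n x" "2 * real m" x] p_bdd[of x] k_bdd[of n x] by auto
    qed
  qed auto
  then have "eventually (\<lambda>n. (LINT x|lborel. \<bar>g x * (p x - k n x)\<bar>) < \<epsilon> / 2) sequentially"
    using \<open>\<epsilon> > 0\<close> by (intro order_tendstoD) auto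
  then obtain n where n: "(LINT x|lborel. \<bar>g x * (p x - k n x)\<bar>) < \<epsilon> / 2"
    by (auto simp: eventually_sequentially)
  have i: "integrable lborel (\<lambda>x. g x * p x)" "integrable lborel (\<lambda>x. g x * k n x)"
    using bdd_int[OF _ p_bdd] bdd_int[OF _ k_bdd[of n]] by auto
  have "(LINT x|lborel. \<bar>g x * (q x - k n x)\<bar>)
      \<le> (LINT x|lborel. \<bar>g x * (q x - p x)\<bar> + \<bar>g x * (p x - k n x)\<bar>)"
    using gq i by (intro integral_mono) (auto simp: right_diff_distrib)
  also have "\<dots> = (LINT x|lborel. \<bar>g x * (q x - p x)\<bar>) + (LINT x|lborel. \<bar>g x * (p x - k n x)\<bar>)"
    using gq i by (intro Bochner_Integration.integral_add) (auto simp: right_diff_distrib)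
  also have "\<dots> < \<epsilon>"
    using m n by (simp add: p_def)
  finally show thesis
    using k_cont k_bdd i(2) by (intro that[of "k n" "real m"]) auto
qed

section \<open>Passage to the Lebesgue measure\<close>

text \<open>Completeness of Lebesgue measure: the preimages under \<open>f\<close> and
  \<open>f'\<close> differ by part of a null set.\<close>

lemma AE_eq_lebesgue_measurable:
  fixes f :: "real \<Rightarrow> real"
  assumes [measurable]: "f' \<in> borel_measurable borel" and eq: "AE u in lborel. f u = f' u"
  shows "f \<in> borel_measurable lebesgue"
proof (rule measurableI)
  fix A :: "real set" assume [measurable]: "A \<in> sets borel"
  have "AE u in lebesgue. f u = f' u" using eq by (rule AE_completion)
  then have "AE u in lebesgue. u \<in> f' -` A \<longleftrightarrow> u \<in> f -` A"
    by eventually_elim simp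
  moreover have "f' -` A \<in> sets lebesgue"
    using measurable_sets_borel[of f' borel A] by simp
  ultimately have "f -` A \<in> sets lebesgue"
    by (rule completion.in_sets_AE) simp
  then show "f -` A \<inter> space lebesgue \<in> sets lebesgue" by simp
qed simp

text \<open>The bridge from arbitrary representatives in \<open>L1\<close> to Borel ones on the
  line, where the Fubini arguments take place. Measurability of \<open>f\<close> on (0,1) is a
  consequence, not a hypothesis.\<close>

lemma
  assumes f' [measurable]: "f' \<in> borel_measurable borel"
    and eq: "AE u in lborel. u \<in> {0<..<1} \<longrightarrow> f u = f' u"
  shows L1_iff_lborel: "f \<in> L1 \<longleftrightarrow> integrable lborel (\<lambda>u. indicat_real {0<..<1} u * f' u)"
    and norm_L1_eq_lborel: "norm_L1 f = (LINT u|lborel. indicat_real {0<..<1} u * \<bar>f' u\<bar>)"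
proof -
  let ?I = "indicat_real {0<..<1}"
  have ae: "AE u in lborel. ?I u * f u = ?I u * f' u" "AE u in lborel. ?I u * \<bar>f u\<bar> = ?I u * \<bar>f' u\<bar>"
    using eq by (auto simp: indicator_def)
  have [measurable]: "(\<lambda>u. ?I u * f u) \<in> borel_measurable lebesgue"
    by (rule AE_eq_lebesgue_measurable[OF _ ae(1)]) measurable
  have [measurable]: "(\<lambda>u. ?I u * \<bar>f u\<bar>) \<in> borel_measurable lebesgue"
    by (rule AE_eq_lebesgue_measurable[OF _ ae(2)]) measurable
  have m: "(\<lambda>u. ?I u * f' u) \<in> borel_measurable lborel" "(\<lambda>u. ?I u * \<bar>f' u\<bar>) \<in> borel_measurable lborel"
    by measurable
  have "f \<in> L1 \<longleftrightarrow> integrable lebesgue (\<lambda>u. ?I u * f u)"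
    by (simp add: L1_def integrable_restrict_space)
  also have "\<dots> \<longleftrightarrow> integrable lebesgue (\<lambda>u. ?I u * f' u)"
    using m by (intro integrable_cong_AE AE_completion ae) (auto intro: measurable_completion)
  also have "\<dots> \<longleftrightarrow> integrable lborel (\<lambda>u. ?I u * f' u)"
    by (rule integrable_completion) (rule m)
  finally show "f \<in> L1 \<longleftrightarrow> integrable lborel (\<lambda>u. ?I u * f' u)" .
  have "norm_L1 f = (LINT u|lebesgue. ?I u * \<bar>f u\<bar>)"
    by (simp add: norm_L1_def integral_restrict_space)
  also have "\<dots> = (LINT u|lebesgue. ?I u * \<bar>f' u\<bar>)"
    using m by (intro integral_cong_AE AE_completion ae) (auto intro: measurable_completion)
  also have "\<dots> = (LINT u|lborel. ?I u * \<bar>f' u\<bar>)"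
    by (rule integral_completion) (rule m)
  finally show "norm_L1 f = (LINT u|lborel. ?I u * \<bar>f' u\<bar>)" .
qed

lemma D1_integrable:
  assumes "h \<in> D1" shows "h \<in> borel_measurable borel" "integrable lborel h"
proof -
  show m: "h \<in> borel_measurable borel"
    using assms by (simp add: D1_def cadlag_borel_measurable)
  then show "integrable lborel h"
    using assms integrable_completion[of h lborel] by (simp add: D1_def)
qed

lemma norm_D1_eq_lborel:
  assumes [measurable]: "h \<in> borel_measurable borel"
  shows "norm_D1 h = (LINT x|lborel. \<bar>h x\<bar>)"
  unfolding norm_D1_def by (rule integral_completion) measurable

text \<open>The given density is a limit of its restrictions to compact subintervals, so it is
  Lebesgue measurable on (0,1) and has a Borel version.\<close>

lemma quantile_density_of_density:
  assumes F: "is_cdf F" and dens: "is_density_of q (quantile F)"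
  obtains q' where "quantile_density F q'" "AE u in lborel. u \<in> {0<..<1} \<longrightarrow> q u = q' u"
proof -
  let ?I = "indicat_real {0<..<1}"
  have q: "\<And>u. u \<in> {0<..<1} \<Longrightarrow> 0 \<le> q u"
    and int: "\<And>a b. 0 < a \<Longrightarrow> a < b \<Longrightarrow> b < 1 \<Longrightarrow> integrable lebesgue (\<lambda>u. indicat_real {a..b} u * q u)"
    and eq: "\<And>a b. 0 < a \<Longrightarrow> a < b \<Longrightarrow> b < 1 \<Longrightarrow>
      quantile F b - quantile F a = (LINT u|lebesgue. indicat_real {a..b} u * q u)"
    using dens by (auto simp: is_density_of_def integrable_restrict_space integral_restrict_space)
  \<comment> \<open>The shift by 3 starts the compact subintervals at [1/3, 2/3]; \<open>int\<close>
    needs a strict inequality between the endpoints, which a shift by 2 would violate at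
    \<open>n = 0\<close>.\<close>
  have "(\<lambda>u. ?I u * q u) \<in> borel_measurable lebesgue"
  proof (rule borel_measurable_LIMSEQ_real)
    fix u :: real
    show "(\<lambda>n. indicat_real {1 / real (n + 3)..1 - 1 / real (n + 3)} u * q u) \<longlonglongrightarrow> ?I u * q u"
    proof (rule tendsto_eventually, cases "u \<in> {0<..<1}")
      case True
      have "(\<lambda>n. 1 / real (n + 3)) \<longlonglongrightarrow> 0"
        using LIMSEQ_ignore_initial_segment[OF lim_1_over_n, of 3] by simp
      then have "eventually (\<lambda>n. 1 / real (n + 3) < min u (1 - u)) sequentially"
        using True by (intro order_tendstoD) auto
      then show "eventually (\<lambda>n. indicat_real {1 / real (n + 3)..1 - 1 / real (n + 3)} u * q u = ?I u * q u) sequentially"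
        by eventually_elim (use True in \<open>auto simp: indicator_def\<close>)
    next
      case False
      have "0 < 1 / real (n + 3)" for n by simp
      then have "indicat_real {1 / real (n + 3)..1 - 1 / real (n + 3)} u = 0" for n
        using False by (smt (verit) atLeastAtMost_iff greaterThanLessThan_iff indicator_simps(2))
      moreover have "?I u = 0" using False by simp
      ultimately show "eventually (\<lambda>n. indicat_real {1 / real (n + 3)..1 - 1 / real (n + 3)} u * q u = ?I u * q u) sequentially"
        by simp
    qed
  next
    fix n :: nat
    show "(\<lambda>u. indicat_real {1 / real (n + 3)..1 - 1 / real (n + 3)} u * q u) \<in> borel_measurable lebesgue"
      by (intro borel_measurable_integrable int) (auto simp: field_simps)
  qed
  then obtain p where p [measurable]: "p \<in> borel_measurable borel" and pq: "AE u in lborel. ?I u * q u = p u"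
    using completion_ex_borel_measurable_real[of "\<lambda>u. ?I u * q u" lborel] by auto
  \<comment> \<open>\<open>p\<close> agrees with the density only almost everywhere; the maximum
    restores nonnegativity at every point and the indicator removes the values off (0,1).\<close>
  define q' where "q' = (\<lambda>u. ?I u * max 0 (p u))"
  have [measurable]: "q' \<in> borel_measurable borel"
    unfolding q'_def by measurable
  have q'_eq: "AE u in lborel. u \<in> {0<..<1} \<longrightarrow> q u = q' u"
    using pq
  proof eventually_elim
    case (elim u)
    then show ?case using q[of u] by (auto simp: q'_def)
  qed
  have conv: "integrable lborel (\<lambda>u. indicat_real {a..b} u * q' u)
      \<and> (LINT u|lborel. indicat_real {a..b} u * q' u) = quantile F b - quantile F a"
    if ab: "0 < a" "a < b" "b < 1" for a b
  proof -
    have ae: "AE u in lebesgue. indicat_real {a..b} u * q' u = indicat_real {a..b} u * q u"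
      using AE_completion[OF q'_eq] by eventually_elim (use ab in \<open>auto simp: indicator_def\<close>)
    have m: "(\<lambda>u. indicat_real {a..b} u * q' u) \<in> borel_measurable lborel"
      by measurable
    then have m': "(\<lambda>u. indicat_real {a..b} u * q' u) \<in> borel_measurable lebesgue"
      by (rule measurable_completion)
    show ?thesis
      using integrable_cong_AE[OF m' borel_measurable_integrable[OF int[OF ab]] ae]
        integral_cong_AE[OF m' borel_measurable_integrable[OF int[OF ab]] ae]
        integrable_completion[OF m] integral_completion[OF m] int[OF ab] eq[OF ab] by simp
  qed
  have "quantile_density F q'"
    by standard (use F conv in \<open>auto simp: q'_def\<close>)
  then show thesis using q'_eq that by blast
qed

text \<open>At a fixed level the gap of cdf values is the signed indicator, in \<open>z\<close>, of
  the interval between the two quantiles. Hence the identity holds at every \<open>u\<close> in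
  (0,1), not just almost everywhere.\<close>

lemma quantile_diff_eq_level_diff:
  assumes "is_cdf G" "is_cdf F" "u \<in> {0<..<1}"
  shows "quantile G u - quantile F u = level_diff G F (\<lambda>_. 1) u"
proof -
  have "gap (G z) (F z) u = (if z < quantile G u then 1 else 0) - (if z < quantile F u then 1 else 0)" for z
    using quantile_le_iff[OF assms(1), of u z] quantile_le_iff[OF assms(2), of u z] assms(3)
    by (auto simp: gap_def)
  then show ?thesis
    by (simp add: level_diff_def integral_gap_shift)
qed

text \<open>Both sides measure the region between the graphs of \<open>G\<close> and of the unit step.\<close>

lemma nn_integral_quantile:
  assumes G: "is_cdf G"
  shows "(\<integral>\<^sup>+u. ennreal \<bar>indicat_real {0<..<1} u * quantile G u\<bar> \<partial>lborel)
    = (\<integral>\<^sup>+x. ennreal \<bar>modified_cdf G x\<bar> \<partial>lborel)"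
proof -
  have [measurable]: "G \<in> borel_measurable borel" by (rule is_cdf_borel_measurable[OF G])
  let ?U = "indicat_real {0..}"
  \<comment> \<open>At \<open>u = 1\<close> the right side also counts all \<open>z \<ge> 0\<close>
    with \<open>G z < 1\<close>, while the left side is 0; this single level is null.\<close>
  have inner: "ennreal \<bar>indicat_real {0<..<1} u * quantile G u\<bar>
      = (\<integral>\<^sup>+z. ennreal \<bar>gap (G z) (?U z) u\<bar> \<partial>lborel)" if "u \<noteq> 1" for u
  proof (cases "u \<in> {0<..<1}")
    case True
    have "\<bar>gap (G z) (?U z) u\<bar> = indicator {min 0 (quantile G u)..<max 0 (quantile G u)} z" for z
      using quantile_le_iff[OF G, of u z] True by (auto simp: gap_def indicator_def)
    then have "(\<integral>\<^sup>+z. ennreal \<bar>gap (G z) (?U z) u\<bar> \<partial>lborel)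
        = (\<integral>\<^sup>+z. indicator {min 0 (quantile G u)..<max 0 (quantile G u)} z \<partial>lborel)"
      by (simp add: ennreal_indicator)
    also have "\<dots> = ennreal \<bar>quantile G u\<bar>" by (simp add: max_def min_def)
    finally show ?thesis using True by simp
  next
    case False
    then have "gap (G z) (?U z) u = 0" for z
      using is_cdf_bounds[OF G, of z] that by (auto simp: gap_def indicator_def)
    then show ?thesis using False by simp
  qed
  have "(\<integral>\<^sup>+u. ennreal \<bar>indicat_real {0<..<1} u * quantile G u\<bar> \<partial>lborel)
      = (\<integral>\<^sup>+u. \<integral>\<^sup>+z. ennreal \<bar>gap (G z) (?U z) u\<bar> \<partial>lborel \<partial>lborel)"
    by (intro nn_integral_cong_AE eventually_mono[OF AE_lborel_singleton[of 1]] inner)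
  also have "\<dots> = (\<integral>\<^sup>+p. ennreal \<bar>gap (G (snd p)) (?U (snd p)) (fst p) * 1\<bar> \<partial>(lborel \<Otimes>\<^sub>M lborel))"
    by (subst lborel.nn_integral_fst[symmetric]) simp_all
  also have "\<dots> = (\<integral>\<^sup>+x. ennreal \<bar>modified_cdf G x\<bar> \<partial>lborel)"
    by (subst nn_integral_gap_pair) (simp_all add: modified_cdf_def)
  finally show ?thesis .
qed

lemma modified_cdf_measurable:
  assumes "is_cdf G" shows "modified_cdf G \<in> borel_measurable borel"
  using is_cdf_borel_measurable[OF assms] unfolding modified_cdf_def by measurable

text \<open>Equality of the two nonnegative integrals, finite or not, turns integrability of one
  function into that of the other. This shows that \<open>quantile_map\<close> takes
  \<open>D_dom F\<close> into \<open>L1\<close>.\<close>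

lemma modified_cdf_D1_iff:
  assumes G: "is_cdf G"
  shows "modified_cdf G \<in> D1 \<longleftrightarrow> quantile G \<in> L1"
proof -
  have [measurable]: "modified_cdf G \<in> borel_measurable borel"
    by (rule modified_cdf_measurable[OF G])
  note [measurable] = quantile_measurable[OF G]
  have "modified_cdf G \<in> D1 \<longleftrightarrow> integrable lborel (modified_cdf G)"
  proof -
    have "cadlag (modified_cdf G)"
      unfolding modified_cdf_def by (intro cadlag_diff is_cdf_cadlag G cadlag_indicator_atLeast)
    moreover have "integrable lebesgue (modified_cdf G) \<longleftrightarrow> integrable lborel (modified_cdf G)"
      by (rule integrable_completion) measurable
    ultimately show ?thesis by (simp add: D1_def)
  qed
  also have "\<dots> \<longleftrightarrow> integrable lborel (\<lambda>u. indicat_real {0<..<1} u * quantile G u)"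
    using nn_integral_quantile[OF G] by (simp add: integrable_iff_bounded)
  \<comment> \<open>The doubled indicator matches \<open>L1_iff_lborel\<close>, whose Borel
    representative is here the already truncated quantile function.\<close>
  also have "\<dots> \<longleftrightarrow> integrable lborel (\<lambda>u. indicat_real {0<..<1} u * (indicat_real {0<..<1} u * quantile G u))"
    by (intro arg_cong[where f = "integrable lborel"]) (auto simp: indicator_def)
  also have "\<dots> \<longleftrightarrow> quantile G \<in> L1"
    by (intro L1_iff_lborel[symmetric] quantile_measurable G) auto
  finally show ?thesis .
qed

section \<open>Hadamard differentiability\<close>

context quantile_density
begin

text \<open>\<open>?X\<close> is the cost of replacing \<open>H\<close> by the tangent direction
  \<open>g \<circ> F\<close>, \<open>?Y\<close> that of replacing the density \<open>q\<close> by
  \<open>k\<close>, and \<open>?Z\<close> is left for \<open>level_diff_shift_tendsto\<close>. The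
  factor 2 arises because \<open>q\<close> is replaced by \<open>k\<close> both in the quotient and
  in its limit \<open>- g q\<close>.\<close>

lemma quantile_diff_decomposition:
  fixes g k G H :: "real \<Rightarrow> real"
  assumes [measurable]: "g \<in> borel_measurable borel" "k \<in> borel_measurable borel" "H \<in> borel_measurable borel"
    and g0: "g 0 = 0" "g 1 = 0" and G: "is_cdf G" and t: "t > 0"
    and GH: "\<And>z. G z = F z + t * H z" and H_int: "integrable lborel H"
    and gq: "integrable lborel (\<lambda>x. g x * q x)" and gk: "integrable lborel (\<lambda>x. g x * k x)"
  shows "(LINT u|lborel. indicat_real {0<..<1} u * \<bar>(quantile G u - quantile F u) / t + g u * q u\<bar>)
    \<le> (LINT z|lborel. \<bar>H z - g (F z)\<bar>) + 2 * (LINT x|lborel. \<bar>g x * (q x - k x)\<bar>)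
      + (LINT u|lborel. indicat_real {0<..<1} u *
           \<bar>level_diff (\<lambda>v. v + t * g v) (\<lambda>v. v) k u / t + g u * k u\<bar>)"
    (is "?L \<le> _")
proof -
  let ?I = "indicat_real {0<..<1}"
  define B where "B = (\<lambda>z. F z + t * g (F z))"
  let ?s = "\<lambda>v. v + t * g v"
  let ?X = "level_diff G B (\<lambda>_. 1)" and ?Y = "level_diff ?s (\<lambda>v. v) (\<lambda>v. q v - k v)"
    and ?Z = "level_diff ?s (\<lambda>v. v) k"
  have [measurable]: "G \<in> borel_measurable borel" by (rule is_cdf_borel_measurable[OF G])
  have [measurable]: "B \<in> borel_measurable borel" unfolding B_def by measurable
  have gF: "integrable lborel (\<lambda>z. g (F z))"
    using integrable_F_iff[of g] g0 gq by simp
  have iX: "integrable lborel (\<lambda>z. (G z - B z) * 1)"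
    using integrable_mult_right[OF Bochner_Integration.integrable_diff[OF H_int gF], of t]
    by (simp add: GH B_def algebra_simps)
  have iB: "integrable lborel (\<lambda>z. (B z - F z) * 1)"
    using integrable_mult_right[OF gF, of t] by (simp add: B_def)
  have iq: "integrable lborel (\<lambda>v. (?s v - v) * q v)" and ik: "integrable lborel (\<lambda>v. (?s v - v) * k v)"
    using integrable_mult_right[OF gq, of t] integrable_mult_right[OF gk, of t] by (simp_all add: mult_ac)
  have iY: "integrable lborel (\<lambda>v. (?s v - v) * (q v - k v))"
    using Bochner_Integration.integrable_diff[OF iq ik] by (simp add: algebra_simps)
  \<comment> \<open>\<open>integral_F\<close> applies because \<open>g\<close> vanishes at 0 and 1,
    where the gap is then between equal levels. Having no integrability hypothesis, it gives the
    identity for every \<open>u\<close>.\<close>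
  have transfer: "level_diff B F (\<lambda>_. 1) u = level_diff ?s (\<lambda>v. v) q u" for u
    using integral_F[of "\<lambda>v. gap (?s v) v u"] g0 by (simp add: level_diff_def B_def)
  have ae1: "AE u in lborel. level_diff G F (\<lambda>_. 1) u = ?X u + level_diff B F (\<lambda>_. 1) u"
    by (rule level_diff_add[OF _ _ _ _ iX iB]) measurable
  have ae2: "AE u in lborel. ?Y u = level_diff ?s (\<lambda>v. v) q u - ?Z u"
    by (rule level_diff_weight_diff[OF _ _ _ _ iq ik]) measurable
  have pw: "AE u in lborel. ?I u * \<bar>(quantile G u - quantile F u) / t + g u * q u\<bar>
      \<le> \<bar>?X u\<bar> / t + \<bar>?Y u\<bar> / t + ?I u * \<bar>?Z u / t + g u * k u\<bar> + \<bar>g u * (q u - k u)\<bar>"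
    using ae1 ae2
  proof eventually_elim
    case (elim u)
    show ?case
    proof (cases "u \<in> {0<..<1}")
      case True
      have "quantile G u - quantile F u = ?X u + (?Y u + ?Z u)"
        using quantile_diff_eq_level_diff[OF G cdf True] elim transfer[of u] by simp
      then have "(quantile G u - quantile F u) / t + g u * q u
          = ?X u / t + ?Y u / t + (?Z u / t + g u * k u) + g u * (q u - k u)"
        by (simp add: add_divide_distrib algebra_simps)
      then have "\<bar>(quantile G u - quantile F u) / t + g u * q u\<bar>
          \<le> \<bar>?X u / t\<bar> + \<bar>?Y u / t\<bar> + \<bar>?Z u / t + g u * k u\<bar> + \<bar>g u * (q u - k u)\<bar>"
        by linarith
      then show ?thesis
        using True by (simp only: abs_divide abs_of_pos[OF t] indicator_simps(1) mult_1_left)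
    next
      case False
      have "0 \<le> \<bar>?X u\<bar> / t" "0 \<le> \<bar>?Y u\<bar> / t" using t by simp_all
      moreover have "?I u = 0" using False by simp
      ultimately show ?thesis by simp
    qed
  qed
  have jX: "integrable lborel ?X" and jY: "integrable lborel ?Y" and jZ: "integrable lborel ?Z"
    and jF: "integrable lborel (level_diff G F (\<lambda>_. 1))"
    using iX iY ik integrable_mult_right[OF H_int, of t]
    by (auto intro!: integrable_level_diff simp: GH)
  have jd: "integrable lborel (\<lambda>u. \<bar>g u * (q u - k u)\<bar>)"
    using gq gk by (auto simp: right_diff_distrib)
  have jI: "integrable lborel (\<lambda>u. ?I u * \<bar>f u\<bar>)" if "integrable lborel f" for f :: "real \<Rightarrow> real"
    using integrable_mult_indicator[OF _ integrable_abs[OF that], of "{0<..<1}"] by simp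
  have jL: "integrable lborel (\<lambda>u. ?I u * \<bar>(quantile G u - quantile F u) / t + g u * q u\<bar>)"
  proof -
    have "(\<lambda>u. ?I u * \<bar>(quantile G u - quantile F u) / t + g u * q u\<bar>)
        = (\<lambda>u. ?I u * \<bar>level_diff G F (\<lambda>_. 1) u / t + g u * q u\<bar>)"
      using quantile_diff_eq_level_diff[OF G cdf] by (auto simp: indicator_def)
    then show ?thesis
      using jI[of "\<lambda>u. level_diff G F (\<lambda>_. 1) u / t + g u * q u"] jF gq by simp
  qed
  have jZ': "integrable lborel (\<lambda>u. ?I u * \<bar>?Z u / t + g u * k u\<bar>)"
    using jZ gk by (intro jI) auto
  have "?L \<le> (LINT u|lborel. \<bar>?X u\<bar> / t + \<bar>?Y u\<bar> / t + ?I u * \<bar>?Z u / t + g u * k u\<bar> + \<bar>g u * (q u - k u)\<bar>)"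
    using jX jY jZ' jd by (intro integral_mono_AE jL pw) auto
  also have "\<dots> = (LINT u|lborel. \<bar>?X u\<bar>) / t + (LINT u|lborel. \<bar>?Y u\<bar>) / t
      + (LINT u|lborel. ?I u * \<bar>?Z u / t + g u * k u\<bar>) + (LINT u|lborel. \<bar>g u * (q u - k u)\<bar>)"
    using jX jY jZ' jd by simp
  also have "(LINT u|lborel. \<bar>?X u\<bar>) / t \<le> (LINT z|lborel. \<bar>H z - g (F z)\<bar>)"
  proof -
    have "(LINT u|lborel. \<bar>?X u\<bar>) \<le> (LINT z|lborel. \<bar>(G z - B z) * 1\<bar>)"
      by (intro level_diff_norm_le iX) measurable
    also have "\<dots> = (LINT z|lborel. t * \<bar>H z - g (F z)\<bar>)"
      using t by (intro Bochner_Integration.integral_cong)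
        (auto simp: GH B_def abs_mult simp flip: right_diff_distrib)
    finally show ?thesis using t by (simp add: field_simps)
  qed
  also have "(LINT u|lborel. \<bar>?Y u\<bar>) / t \<le> (LINT x|lborel. \<bar>g x * (q x - k x)\<bar>)"
  proof -
    have "(LINT u|lborel. \<bar>?Y u\<bar>) \<le> (LINT v|lborel. \<bar>(?s v - v) * (q v - k v)\<bar>)"
      by (intro level_diff_norm_le iY) measurable
    also have "\<dots> = (LINT v|lborel. t * \<bar>g v * (q v - k v)\<bar>)"
      using t by (intro Bochner_Integration.integral_cong) (auto simp: abs_mult)
    finally show ?thesis using t by (simp add: field_simps)
  qed
  finally show ?thesis by simp
qed

text \<open>The approximant \<open>k\<close> is chosen before \<open>n\<close>. This order is
  possible because its contribution to \<open>quantile_diff_decomposition\<close> does not depend on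
  \<open>t n\<close>.\<close>

lemma quantile_differentiable:
  fixes g :: "real \<Rightarrow> real" and t :: "nat \<Rightarrow> real" and G H :: "nat \<Rightarrow> real \<Rightarrow> real"
  assumes g: "continuous_on UNIV g" "\<And>x. x \<notin> {0<..<1} \<Longrightarrow> g x = 0"
    and gF: "integrable lborel (\<lambda>z. g (F z))"
    and G: "\<And>n. is_cdf (G n)" and t: "\<And>n. t n > 0" "t \<longlonglongrightarrow> 0"
    and GH: "\<And>n z. G n z = F z + t n * H n z" and H_int: "\<And>n. integrable lborel (H n)"
    and lim: "(\<lambda>n. LINT z|lborel. \<bar>H n z - g (F z)\<bar>) \<longlonglongrightarrow> 0"
  shows "(\<lambda>n. LINT u|lborel. indicat_real {0<..<1} u *
      \<bar>(quantile (G n) u - quantile F u) / t n + g u * q u\<bar>) \<longlonglongrightarrow> 0" (is "?L \<longlonglongrightarrow> 0")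
proof -
  have g_meas [measurable]: "g \<in> borel_measurable borel"
    using g by (auto intro: borel_measurable_continuous_onI)
  have [measurable]: "H n \<in> borel_measurable borel" for n
    using borel_measurable_integrable[OF H_int] by simp
  have gq: "integrable lborel (\<lambda>x. g x * q x)"
    using integrable_F_iff[of g] g(2) gF by simp
  obtain M where M: "\<bar>g x\<bar> \<le> M" for x
  proof -
    have "compact (g ` {0..1})"
      by (intro compact_continuous_image continuous_on_subset[OF g(1)]) auto
    then obtain M where "\<And>x. x \<in> {0..1} \<Longrightarrow> \<bar>g x\<bar> \<le> M"
      using compact_imp_bounded bounded_iff by (metis imageI real_norm_def)
    moreover from this[of 0] have "0 \<le> M" by simp
    ultimately have "\<bar>g x\<bar> \<le> M" for x
      using g(2)[of x] by (cases "x \<in> {0..1}") auto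
    then show thesis by (rule that)
  qed
  show ?thesis
  proof (rule order_tendstoI)
    fix \<epsilon> :: real assume "\<epsilon> < 0"
    moreover have "0 \<le> ?L n" for n by (intro integral_nonneg_AE) auto
    ultimately show "eventually (\<lambda>n. \<epsilon> < ?L n) sequentially"
      by (intro always_eventually allI) (rule less_le_trans)
  next
    fix \<epsilon> :: real assume "0 < \<epsilon>"
    \<comment> \<open>One quarter goes to \<open>H n\<close>, two to the doubled error of
      \<open>k\<close>, and one to the continuous case.\<close>
    then have pos: "0 < \<epsilon> / 4" by simp
    have g0: "g x = 0" if "x \<notin> {0..1}" for x
      using that g(2)[of x] by auto
    obtain k C where k: "continuous_on UNIV k" "\<And>x. \<bar>k x\<bar> \<le> C"
      and gk: "integrable lborel (\<lambda>x. g x * k x)"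
      and k_near: "(LINT x|lborel. \<bar>g x * (q x - k x)\<bar>) < \<epsilon> / 4"
      using weighted_approx_continuous[OF g_meas q_measurable M g0 q_nonneg gq pos] by blast
    have [measurable]: "k \<in> borel_measurable borel"
      using k by (auto intro: borel_measurable_continuous_onI)
    have "eventually (\<lambda>n. (LINT z|lborel. \<bar>H n z - g (F z)\<bar>) < \<epsilon> / 4) sequentially"
      using \<open>0 < \<epsilon>\<close> by (intro order_tendstoD[OF lim]) simp
    moreover have "eventually (\<lambda>n. (LINT u|lborel. indicat_real {0<..<1} u *
        \<bar>level_diff (\<lambda>v. v + t n * g v) (\<lambda>v. v) k u / t n + g u * k u\<bar>) < \<epsilon> / 4) sequentially"
      using \<open>0 < \<epsilon>\<close> by (intro order_tendstoD[OF level_diff_shift_tendsto[OF g(1) M k t]]) simp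
    ultimately show "eventually (\<lambda>n. ?L n < \<epsilon>) sequentially"
    proof eventually_elim
      case (elim n)
      have "?L n \<le> (LINT z|lborel. \<bar>H n z - g (F z)\<bar>) + 2 * (LINT x|lborel. \<bar>g x * (q x - k x)\<bar>)
        + (LINT u|lborel. indicat_real {0<..<1} u *
           \<bar>level_diff (\<lambda>v. v + t n * g v) (\<lambda>v. v) k u / t n + g u * k u\<bar>)"
        using g(2) by (intro quantile_diff_decomposition G t GH H_int gq gk) auto
      then show ?case using elim k_near by linarith
    qed
  qed
qed

end

theorem theorem2p1:
  fixes F Q q :: "real \<Rightarrow> real"
  assumes "is_cdf F"
    and "Q = quantile F"
    and "Q \<in> L1"
    and "locally_absolutely_continuous Q"
    and "is_density_of q Q"
  shows "(\<forall>h\<in>D1. (\<lambda>u. (h \<circ> Q) u * q u) \<in> L1) \<and>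
    (\<exists>\<phi>'. has_hadamard_derivative quantile_map (D_dom F) (modified_cdf F) (T_space F) \<phi>' \<and>
       (\<forall>h\<in>T_space F. eq_L1 (\<phi>' h) (\<lambda>u. - ((h \<circ> Q) u * q u)))) \<and>
    continuous_linear_L1 D1 (\<lambda>h u. - ((h \<circ> Q) u * q u))"
proof -
  let ?I = "indicat_real {0<..<1}"
  let ?A = "\<lambda>h u. - ((h \<circ> Q) u * q u)"
  obtain q' where q': "quantile_density F q'" and qq': "AE u in lborel. u \<in> {0<..<1} \<longrightarrow> q u = q' u"
    using quantile_density_of_density[of F q] assms by blast
  interpret quantile_density F q' by (rule q')
  note [measurable] = q_measurable Q_measurable F_measurable
  \<comment> \<open>The truncated quantile function of the locale; it agrees with \<open>Q\<close>
    on (0,1), which is all that \<open>L1\<close> sees.\<close>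
  define Q' where "Q' = quantile_density.Q F"
  have Q': "Q u = Q' u" if "u \<in> {0<..<1}" for u
    using that by (simp add: Q'_def Q_def assms(2))
  have [measurable]: "Q' \<in> borel_measurable borel" unfolding Q'_def by measurable
  have rep: "AE u in lborel. u \<in> {0<..<1} \<longrightarrow> h (Q u) * q u = h (Q' u) * q' u" for h
    using qq' by eventually_elim (simp add: Q')
  have I_q': "?I u * (c * q' u) = c * q' u" for u c
    using q_outside[of u] by (auto simp: indicator_def)
  have norm_bound: "norm_L1 (\<lambda>u. h (Q u) * q u) \<le> (LINT z|lborel. \<bar>h z\<bar>)" and
    mem: "(\<lambda>u. h (Q u) * q u) \<in> L1"
    if [measurable]: "h \<in> borel_measurable borel" and int: "integrable lborel h" for h
  proof -
    have m: "(\<lambda>u. h (Q' u) * q' u) \<in> borel_measurable borel" by measurable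
    show "(\<lambda>u. h (Q u) * q u) \<in> L1"
      using integrable_Q(1)[OF that] by (subst L1_iff_lborel[OF m rep]) (simp add: I_q' Q'_def)
    have "norm_L1 (\<lambda>u. h (Q u) * q u) = (LINT u|lborel. ?I u * \<bar>h (Q' u) * q' u\<bar>)"
      by (rule norm_L1_eq_lborel[OF m rep])
    also have "\<dots> = (LINT u|lborel. \<bar>h (Q' u) * q' u\<bar>)"
      using q_outside by (intro Bochner_Integration.integral_cong) (auto simp: indicator_def)
    also have "\<dots> \<le> (LINT z|lborel. \<bar>h z\<bar>)"
      unfolding Q'_def by (rule integrable_Q(2)[OF that])
    finally show "norm_L1 (\<lambda>u. h (Q u) * q u) \<le> (LINT z|lborel. \<bar>h z\<bar>)" .
  qed
  have L1_uminus: "(\<lambda>u. - f u) \<in> L1" if "f \<in> L1" for f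
    using that by (simp add: L1_def)
  \<comment> \<open>Stated for any \<open>V\<close> inside \<open>D1\<close> because it is used
    twice, for the tangent space and for the extension to all of \<open>D1\<close>.\<close>
  have cont: "continuous_linear_L1 V ?A" if "V \<subseteq> D1" for V
    unfolding continuous_linear_L1_def
  proof (intro conjI ballI allI impI)
    fix h assume "h \<in> V"
    then have h: "h \<in> D1" using that by auto
    show "?A h \<in> L1"
      using mem[OF D1_integrable[OF h]] by (simp add: L1_uminus)
    show "eq_L1 (?A (\<lambda>x. c * h x)) (\<lambda>u. c * ?A h u)" for c
      by (simp add: eq_L1_def)
    show "eq_L1 (?A (\<lambda>x. h x + k x)) (\<lambda>u. ?A h u + ?A k u)" for k
      by (simp add: eq_L1_def algebra_simps)
    fix \<epsilon> :: real assume "0 < \<epsilon>"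
    show "\<exists>\<delta>>0. \<forall>k\<in>V. norm_D1 (\<lambda>x. k x - h x) < \<delta> \<longrightarrow> norm_L1 (\<lambda>u. ?A k u - ?A h u) < \<epsilon>"
    \<comment> \<open>The map is a contraction, so \<open>\<delta> = \<epsilon>\<close>
      works.\<close>
    proof (intro exI[of _ \<epsilon>] conjI ballI impI \<open>0 < \<epsilon>\<close>)
      fix k assume "k \<in> V" and small: "norm_D1 (\<lambda>x. k x - h x) < \<epsilon>"
      then have k: "k \<in> D1" using that by auto
      note [measurable] = D1_integrable(1)[OF h] D1_integrable(1)[OF k]
      have "norm_L1 (\<lambda>u. ?A k u - ?A h u) = norm_L1 (\<lambda>u. (k (Q u) - h (Q u)) * q u)"
        by (simp add: norm_L1_def algebra_simps abs_minus_commute)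
      also have "\<dots> \<le> norm_D1 (\<lambda>x. k x - h x)"
        using norm_bound[of "\<lambda>x. k x - h x"] D1_integrable[OF h] D1_integrable[OF k]
        by (subst norm_D1_eq_lborel) auto
      finally show "norm_L1 (\<lambda>u. ?A k u - ?A h u) < \<epsilon>" using small by simp
    qed
  qed
  have T_D1: "T_space F \<subseteq> D1" by (auto simp: T_space_def)
  have D_D1: "D_dom F \<subseteq> D1" by (auto simp: D_dom_def)
  have F_bounds: "0 \<le> F x" "F x \<le> 1" for x using is_cdf_bounds[OF cdf] by auto
  have lower: "(F \<longlongrightarrow> 0) (at_left a)" if "lower_endpoint F = ereal a" for a
  proof (rule tendsto_eventually)
    have "F x = 0" if "x < a" for x
    proof (rule ccontr)
      assume "F x \<noteq> 0"
      then have "0 < F x" using F_bounds[of x] by simp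
      then have "lower_endpoint F \<le> ereal x"
        unfolding lower_endpoint_def by (intro Inf_lower) auto
      with \<open>lower_endpoint F = ereal a\<close> that show False by simp
    qed
    then show "eventually (\<lambda>x. F x = 0) (at_left a)"
      by (auto simp: eventually_at_filter)
  qed
  have upper: "(F \<longlongrightarrow> 1) (at_right b)" if "upper_endpoint F = ereal b" for b
  proof (rule tendsto_eventually)
    have "F x = 1" if "b < x" for x
    proof (rule ccontr)
      assume "F x \<noteq> 1"
      then have "F x < 1" using F_bounds[of x] by simp
      then have "ereal x \<le> upper_endpoint F"
        unfolding upper_endpoint_def by (intro Sup_upper) auto
      with \<open>upper_endpoint F = ereal b\<close> that show False by simp
    qed
    then show "eventually (\<lambda>x. F x = 1) (at_right b)"
      by (auto simp: eventually_at_filter)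
  qed
  have F_dom: "modified_cdf F \<in> D_dom F"
    using modified_cdf_D1_iff[OF cdf] assms(2,3) cdf lower upper by (auto simp: D_dom_def)
  have map_L1: "quantile_map g \<in> L1" if "g \<in> D_dom F" for g
    using that modified_cdf_D1_iff by (auto simp: D_dom_def quantile_map_modified_cdf)
  have main: "(\<lambda>n. norm_L1 (\<lambda>u. (quantile_map (\<lambda>x. modified_cdf F x + t n * H n x) u
        - quantile_map (modified_cdf F) u) / t n - ?A h u)) \<longlonglongrightarrow> 0"
    if h: "h \<in> T_space F" and t: "\<forall>n. t n > 0" "t \<longlonglongrightarrow> 0" and H: "\<forall>n. H n \<in> D1"
      and lim: "(\<lambda>n. norm_D1 (\<lambda>x. H n x - h x)) \<longlonglongrightarrow> 0"
      and dom: "\<forall>n. (\<lambda>x. modified_cdf F x + t n * H n x) \<in> D_dom F"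
    for h t and H :: "nat \<Rightarrow> real \<Rightarrow> real"
  proof -
    obtain g0 where g0: "continuous_on {0..1} g0" "g0 0 = 0" "g0 1 = 0" "h = g0 \<circ> F" and "h \<in> D1"
      using h by (auto simp: T_space_def)
    \<comment> \<open>Clamping the argument extends \<open>g0\<close> continuously to the line;
      since \<open>g0\<close> vanishes at both ends, the extension is zero off (0,1).\<close>
    define g where "g = (\<lambda>x. g0 (max 0 (min 1 x)))"
    have g_cont: "continuous_on UNIV g"
      unfolding g_def by (intro continuous_on_compose2[OF g0(1)] continuous_intros) auto
    have g_out: "g x = 0" if "x \<notin> {0<..<1}" for x
      using that g0(2,3) by (cases "x \<le> 0") (auto simp: g_def max_def min_def)
    have hg: "h = (\<lambda>z. g (F z))"
    proof -
      have "max 0 (min 1 (F z)) = F z" for z using F_bounds[of z] by simp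
      then show ?thesis by (simp add: g0(4) g_def comp_def)
    qed
    have [measurable]: "g \<in> borel_measurable borel"
      using g_cont by (rule borel_measurable_continuous_onI)
    note [measurable] = D1_integrable(1)[OF H[rule_format]]
    have "\<exists>G. is_cdf G \<and> (\<lambda>x. modified_cdf F x + t n * H n x) = modified_cdf G" for n
      using dom by (auto simp: D_dom_def)
    then obtain G where G: "\<And>n. is_cdf (G n)"
      and G_eq: "\<And>n. (\<lambda>x. modified_cdf F x + t n * H n x) = modified_cdf (G n)"
      by metis
    have GH: "G n z = F z + t n * H n z" for n z
      using fun_cong[OF G_eq[of n], of z] by (simp add: modified_cdf_def)
    have "(\<lambda>n. LINT u|lborel. ?I u * \<bar>(quantile (G n) u - quantile F u) / t n + g u * q' u\<bar>) \<longlonglongrightarrow> 0"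
    proof (rule quantile_differentiable[OF g_cont g_out])
      show "integrable lborel (\<lambda>z. g (F z))"
        using D1_integrable[OF \<open>h \<in> D1\<close>] by (simp add: hg)
      show "(\<lambda>n. LINT z|lborel. \<bar>H n z - g (F z)\<bar>) \<longlonglongrightarrow> 0"
        using lim by (simp add: norm_D1_eq_lborel hg)
    qed (use G GH t D1_integrable H in auto)
    moreover have "norm_L1 (\<lambda>u. (quantile_map (\<lambda>x. modified_cdf F x + t n * H n x) u
          - quantile_map (modified_cdf F) u) / t n - ?A h u)
        = (LINT u|lborel. ?I u * \<bar>(quantile (G n) u - quantile F u) / t n + g u * q' u\<bar>)" for n
    proof -
      let ?f = "\<lambda>u. (?I u * quantile (G n) u - ?I u * quantile F u) / t n + g u * q' u"
      note [measurable] = quantile_measurable[OF G[of n]] quantile_measurable[OF cdf]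
      have "norm_L1 (\<lambda>u. (quantile (G n) u - quantile F u) / t n + g (F (Q u)) * q u)
          = (LINT u|lborel. ?I u * \<bar>?f u\<bar>)"
      proof (rule norm_L1_eq_lborel)
        show "?f \<in> borel_measurable borel" by measurable
        \<comment> \<open>Either \<open>q' u = 0\<close> and both products vanish, or
          \<open>F (Q u) = u\<close> by \<open>AE_F_Q\<close>; this is how
          \<open>(h \<circ> Q) q\<close> becomes \<open>g q'\<close>.\<close>
        show "AE u in lborel. u \<in> {0<..<1} \<longrightarrow>
            (quantile (G n) u - quantile F u) / t n + g (F (Q u)) * q u = ?f u"
          using qq' AE_F_Q
        proof eventually_elim
          case (elim u)
          then show ?case
            using Q'[of u] by (cases "q' u = 0") (auto simp: Q'_def)
        qed
      qed
      also have "\<dots> = (LINT u|lborel. ?I u * \<bar>(quantile (G n) u - quantile F u) / t n + g u * q' u\<bar>)"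
        by (intro Bochner_Integration.integral_cong) (auto simp: indicator_def)
      finally show ?thesis
        by (simp add: G_eq quantile_map_modified_cdf hg)
    qed
    ultimately show ?thesis by simp
  qed
  have "has_hadamard_derivative quantile_map (D_dom F) (modified_cdf F) (T_space F) ?A"
    unfolding has_hadamard_derivative_def
    using D_D1 F_dom map_L1 T_D1 cont[OF T_D1] main by blast
  moreover have "\<forall>h\<in>T_space F. eq_L1 (?A h) (\<lambda>u. - ((h \<circ> Q) u * q u))"
    by (simp add: eq_L1_def)
  moreover have "\<forall>h\<in>D1. (\<lambda>u. (h \<circ> Q) u * q u) \<in> L1"
    using mem D1_integrable by simp
  ultimately show ?thesis using cont[of D1] by blast
qed

end
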